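(* Let $K=\mathbb{Q}(\sqrt{-2})$. The cube graph is a forest of trees in which every vertex has valence $6$. Consequently the group $\widehat{\mathcal{A}}$ generated by the six matrices $$\begin{pmatrix}1&0&3&3\\0&1&3&3\\0&0&0&-1\\0&0&-1&0\end{pmatrix},\ \begin{pmatrix}1&3&0&3\\0&0&0&-1\\0&3&1&3\\0&-1&0&0\end{pmatrix},\ \begin{pmatrix}0&0&0&-1\\3&1&0&3\\3&0&1&3\\-1&0&0&0\end{pmatrix},$$ $$\begin{pmatrix}1&3&3&0\\0&0&-1&0\\0&-1&0&0\\0&3&3&1\end{pmatrix},\ \begin{pmatrix}0&0&-1&0\\3&1&3&0\\-1&0&0&0\\3&0&3&1\end{pmatrix},\ \begin{pmatrix}0&-1&0&0\\-1&0&0&0\\3&3&1&0\\3&3&0&1\end{pmatrix}$$ is freely generated by them as a free product of six copies of $\mathbb{Z}/2\mathbb{Z}$ (each generator having order $2$ and there being no further relations).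
   Context: Every oriented circle $C$ in $\widehat{\mathbb{C}}$ (lines included) is uniquely $\{X/Y: bX\overline{X}-aY\overline{X}-\overline{a}X\overline{Y}+b'Y\overline{Y}=0\}$ with $b,b'\in\mathbb{R}$, $a\in\mathbb{C}$, $bb'=|a|^2-1$, sign of $b$ = orientation (positive = counterclockwise), and for lines ($b=0$) $a$ the unit normal pointing from exterior to interior (interior = left of the direction of travel). Set $\pi(C)=(b',b,\mathrm{Re}\,a,\mathrm{Im}\,a)\in\mathbb{R}^4$ and define the Pedoe product $\langle(b'_1,b_1,r_1,m_1),(b'_2,b_2,r_2,m_2)\rangle=-\tfrac12(b'_1b_2+b_1b'_2)+r_1r_2+m_1m_2$. A $\mathbb{Q}(\sqrt{-2})$-Bianchi circle is $M(\widehat{\mathbb{R}})$ with $M\in\mathrm{PSL}_2(\mathbb{Z}[\sqrt{-2}])$. A cube is an 8-tuple $(C_1,\dots,C_8)$ of oriented $\mathbb{Q}(\sqrt{-2})$-Bianchi circles whose Pedoe products $\langle\pi(C_i),\pi(C_j)\rangle$ form the matrix with rows $(1,-1,-3,-1,-5,-3,-1,-3)$, $(-1,1,-1,-3,-3,-5,-3,-1)$, $(-3,-1,1,-1,-1,-3,-5,-3)$, $(-1,-3,-1,1,-3,-1,-3,-5)$, $(-5,-3,-1,-3,1,-1,-3,-1)$, $(-3,-5,-3,-1,-1,1,-1,-3)$, $(-1,-3,-5,-3,-3,-1,1,-1)$, $(-3,-1,-3,-5,-1,-3,-1,1)$. Its sides (faces) are the six 4-element sets $\{C_1,C_2,C_3,C_4\}$,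 $\{C_5,C_6,C_7,C_8\}$, $\{C_1,C_2,C_8,C_7\}$, $\{C_2,C_3,C_5,C_8\}$, $\{C_3,C_4,C_6,C_5\}$, $\{C_1,C_4,C_6,C_7\}$. The cube graph has as vertices the cubes considered as unordered sets of circles, with an edge between two cubes sharing a side. The six matrices act by right multiplication on $4\times4$ real matrices whose columns are $\pi(C_1),\pi(C_3),\pi(C_6),\pi(C_8)$ for a cube, each realising the replacement of a cube by the other cube sharing one of its sides. *)

theory Defs
  imports "HOL-Analysis.Analysis" "HOL-Algebra.Elementary_Groups" "HOL-Algebra.Multiplicative_Group"
begin

section \<open>Oriented circles in the Riemann sphere\<close>

type_synonym riemann_sphere = "complex option"

(* The point X/Y of the Riemann sphere, for (X, Y) \<noteq> (0, 0); None is the point at infinity. *)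
definition quot_pt :: "complex \<Rightarrow> complex \<Rightarrow> riemann_sphere" where
  "quot_pt X Y = (if Y = 0 then None else Some (X / Y))"

(* An oriented circle is a circle together with its interior, the side to the left of the
   direction of travel; of the two complementary components, this is the one that encodes
   the orientation. *)
type_synonym ocircle = "riemann_sphere set \<times> riemann_sphere set"

definition ccw_circle :: "complex \<Rightarrow> real \<Rightarrow> ocircle" where
  "ccw_circle c r = (Some ` sphere c r, Some ` ball c r)"

definition cw_circle :: "complex \<Rightarrow> real \<Rightarrow> ocircle" where
  "cw_circle c r = (Some ` sphere c r, insert None (Some ` (- cball c r)))"

(* The line through p travelled in the direction d, |d| = 1. *)
definition oriented_line :: "complex \<Rightarrow> complex \<Rightarrow> ocircle" where
  "oriented_line p d =
    (insert None (Some ` {p + of_real t * d | t. True}), Some ` {z. Im ((z - p) * cnj d) > 0})"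

definition oriented_circle :: "ocircle \<Rightarrow> bool" where
  "oriented_circle C \<longleftrightarrow>
    (\<exists>c r. r > 0 \<and> (C = ccw_circle c r \<or> C = cw_circle c r)) \<or>
    (\<exists>p d. norm d = 1 \<and> C = oriented_line p d)"

definition circle_points :: "real \<Rightarrow> real \<Rightarrow> complex \<Rightarrow> riemann_sphere set" where
  "circle_points b' b a = {quot_pt X Y | X Y. (X, Y) \<noteq> (0, 0) \<and>
     of_real b * X * cnj X - a * Y * cnj X - cnj a * X * cnj Y + of_real b' * Y * cnj Y = 0}"

(* For b = 0 the last clause says that a points from the exterior to the interior; that it
   is a unit normal follows from the other two clauses. *)
definition circle_coords :: "ocircle \<Rightarrow> real \<Rightarrow> real \<Rightarrow> complex \<Rightarrow> bool" where
  "circle_coords C b' b a \<longleftrightarrow>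
     b * b' = (norm a)\<^sup>2 - 1 \<and>
     fst C = circle_points b' b a \<and>
     (b > 0 \<longleftrightarrow> (\<exists>c r. r > 0 \<and> C = ccw_circle c r)) \<and>
     (b < 0 \<longleftrightarrow> (\<exists>c r. r > 0 \<and> C = cw_circle c r)) \<and>
     (b = 0 \<longrightarrow> (\<forall>z. Some z \<in> fst C \<longrightarrow> Some (z + a) \<in> snd C))"

(* The coordinates exist and are unique for oriented circles: see circle_coords_unique. *)
definition circle_vec :: "ocircle \<Rightarrow> real^4" where
  "circle_vec C = (THE v. \<exists>b' b a. circle_coords C b' b a \<and> v = vector [b', b, Re a, Im a])"

definition pedoe :: "real^4 \<Rightarrow> real^4 \<Rightarrow> real" where
  "pedoe v w = - (v$1 * w$2 + v$2 * w$1) / 2 + v$3 * w$3 + v$4 * w$4"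

lemma vector_4 [simp]:
  "(vector [w, x, y, z] :: 'a::zero^4) $ 1 = w"
  "(vector [w, x, y, z] :: 'a::zero^4) $ 2 = x"
  "(vector [w, x, y, z] :: 'a::zero^4) $ 3 = y"
  "(vector [w, x, y, z] :: 'a::zero^4) $ 4 = z"
  unfolding vector_def by auto

(* The equation of circle_points in the affine coordinate z = X / Y. *)
definition circle_form :: "real \<Rightarrow> real \<Rightarrow> complex \<Rightarrow> complex \<Rightarrow> real" where
  "circle_form b' b a z = b * ((Re z)\<^sup>2 + (Im z)\<^sup>2) - 2 * (Re a * Re z + Im a * Im z) + b'"

lemma None_circle_points: "None \<in> circle_points b' b a \<longleftrightarrow> b = 0"
proof
  assume "b = 0" then show "None \<in> circle_points b' b a"
    unfolding circle_points_def mem_Collect_eq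
    by (intro exI[of _ 1] exI[of _ 0]) (simp add: quot_pt_def)
qed (auto simp: circle_points_def quot_pt_def split: if_splits)

lemma Some_circle_points: "Some z \<in> circle_points b' b a \<longleftrightarrow> circle_form b' b a z = 0"
proof -
  have *: "of_real b * (z * Y) * cnj (z * Y) - a * Y * cnj (z * Y) - cnj a * (z * Y) * cnj Y
      + of_real b' * Y * cnj Y = of_real (circle_form b' b a z) * (Y * cnj Y)" for Y
    by (rule complex_eqI) (auto simp: circle_form_def algebra_simps power2_eq_square)
  show ?thesis
  proof
    assume "Some z \<in> circle_points b' b a"
    then obtain X Y where "Y \<noteq> 0" "z = X / Y" and
      e: "of_real b * X * cnj X - a * Y * cnj X - cnj a * X * cnj Y + of_real b' * Y * cnj Y = 0"
      unfolding circle_points_def quot_pt_def by (auto split: if_splits)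
    then have "X = z * Y" by simp
    with e * \<open>Y \<noteq> 0\<close> show "circle_form b' b a z = 0" by simp
  next
    assume "circle_form b' b a z = 0"
    with *[of 1] show "Some z \<in> circle_points b' b a"
      unfolding circle_points_def mem_Collect_eq
      by (intro exI[of _ z] exI[of _ 1]) (simp add: quot_pt_def)
  qed
qed

lemma mem_sphere_form: "r > 0 \<Longrightarrow> z \<in> sphere c r \<longleftrightarrow> circle_form ((cmod c)\<^sup>2 - r\<^sup>2) 1 c z = 0"
proof -
  assume r: "r > 0"
  have "z \<in> sphere c r \<longleftrightarrow> (cmod (c - z))\<^sup>2 = r\<^sup>2" using r by (simp add: dist_norm)
  then show ?thesis unfolding circle_form_def cmod_power2 by (auto simp: power2_eq_square algebra_simps)
qed

lemma circle_points_sphere: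
  assumes "r > 0" "s \<noteq> 0"
  shows "circle_points (s * ((cmod c)\<^sup>2 - r\<^sup>2)) s (of_real s * c) = Some ` sphere c r"
proof -
  have "circle_form (s * ((cmod c)\<^sup>2 - r\<^sup>2)) s (of_real s * c) z = s * circle_form ((cmod c)\<^sup>2 - r\<^sup>2) 1 c z" for z
    unfolding circle_form_def by (simp add: algebra_simps)
  then have "x \<in> circle_points (s * ((cmod c)\<^sup>2 - r\<^sup>2)) s (of_real s * c) \<longleftrightarrow> x \<in> Some ` sphere c r" for x
    using mem_sphere_form[OF assms(1)] assms(2)
    by (cases x) (auto simp: None_circle_points Some_circle_points image_iff)
  then show ?thesis by blast
qed

lemma distinct_kinds:
  "ccw_circle c r \<noteq> cw_circle c' r'" "cw_circle c' r' \<noteq> ccw_circle c r"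
  "oriented_line p d \<noteq> ccw_circle c r" "oriented_line p d \<noteq> cw_circle c r"
  by (auto simp: ccw_circle_def cw_circle_def oriented_line_def)

lemma sphere_unique:
  assumes r: "r > 0" and s: "circle_points b' b a = Some ` sphere c r" and e: "b * b' = (cmod a)\<^sup>2 - 1"
  shows "a = of_real b * c" "b' = b * ((cmod c)\<^sup>2 - r\<^sup>2)" "b\<^sup>2 * r\<^sup>2 = 1"
proof -
  have f: "circle_form b' b a z = 0" if "z \<in> sphere c r" for z
    using that s Some_circle_points by blast
  have "c + of_real r \<in> sphere c r" "c - of_real r \<in> sphere c r"
    "c + of_real r * \<i> \<in> sphere c r" "c - of_real r * \<i> \<in> sphere c r"
    using r by (auto simp: dist_norm norm_mult)
  note g = this[THEN f, unfolded circle_form_def]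
  have "4 * r * (b * Re c - Re a) = circle_form b' b a (c + of_real r) - circle_form b' b a (c - of_real r)"
    by (simp add: circle_form_def power2_eq_square algebra_simps)
  also have "\<dots> = 0" unfolding circle_form_def g(1,2) by simp
  finally have "4 * r * (b * Re c - Re a) = 0" .
  then have ra: "Re a = b * Re c" using r by simp
  have "4 * r * (b * Im c - Im a) = circle_form b' b a (c + of_real r * \<i>) - circle_form b' b a (c - of_real r * \<i>)"
    by (simp add: circle_form_def power2_eq_square algebra_simps)
  also have "\<dots> = 0" unfolding circle_form_def g(3,4) by simp
  finally have "4 * r * (b * Im c - Im a) = 0" .
  then have ia: "Im a = b * Im c" using r by simp
  show a: "a = of_real b * c" by (rule complex_eqI) (auto simp: ra ia)
  show b': "b' = b * ((cmod c)\<^sup>2 - r\<^sup>2)"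
    using g(1) by (simp add: ra ia cmod_power2) (simp add: power2_eq_square algebra_simps)
  show "b\<^sup>2 * r\<^sup>2 = 1" using e unfolding b' a norm_mult
    by (simp add: power_mult_distrib) (simp add: power2_eq_square algebra_simps)
qed

lemma coords_ccw:
  assumes "r > 0"
  shows "circle_coords (ccw_circle c r) b' b a \<longleftrightarrow>
    b = 1 / r \<and> a = c / of_real r \<and> b' = ((cmod c)\<^sup>2 - r\<^sup>2) / r"
proof
  assume h: "circle_coords (ccw_circle c r) b' b a"
  then have b: "b > 0" using assms unfolding circle_coords_def by blast
  have s: "circle_points b' b a = Some ` sphere c r" and e: "b * b' = (cmod a)\<^sup>2 - 1"
    using h by (auto simp: circle_coords_def ccw_circle_def)
  note u = sphere_unique[OF assms s e]
  have "(b * r)\<^sup>2 = 1" using u(3) by (simp add: power_mult_distrib)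
  then have "b * r = 1" using assms b by (simp add: power2_eq_1_iff) (smt (verit) mult_pos_pos)
  then have "b = 1 / r" using assms by (simp add: field_simps)
  with u show "b = 1 / r \<and> a = c / of_real r \<and> b' = ((cmod c)\<^sup>2 - r\<^sup>2) / r" by simp
next
  assume h: "b = 1 / r \<and> a = c / of_real r \<and> b' = ((cmod c)\<^sup>2 - r\<^sup>2) / r"
  have "circle_points b' b a = Some ` sphere c r"
    using circle_points_sphere[OF assms, of "1/r" c] assms h by simp
  moreover have "b * b' = (norm a)\<^sup>2 - 1" unfolding h[THEN conjunct1] h[THEN conjunct2, THEN conjunct1]
      h[THEN conjunct2, THEN conjunct2] using assms
    by (simp add: norm_divide field_simps power2_eq_square)
  ultimately show "circle_coords (ccw_circle c r) b' b a"
    unfolding circle_coords_def using h assms distinct_kinds by (auto simp: ccw_circle_def cw_circle_def)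
qed

lemma coords_cw:
  assumes "r > 0"
  shows "circle_coords (cw_circle c r) b' b a \<longleftrightarrow>
    b = - 1 / r \<and> a = - c / of_real r \<and> b' = - ((cmod c)\<^sup>2 - r\<^sup>2) / r"
proof
  assume h: "circle_coords (cw_circle c r) b' b a"
  then have b: "b < 0" using assms unfolding circle_coords_def by blast
  have s: "circle_points b' b a = Some ` sphere c r" and e: "b * b' = (cmod a)\<^sup>2 - 1"
    using h by (auto simp: circle_coords_def cw_circle_def)
  note u = sphere_unique[OF assms s e]
  have "(b * r)\<^sup>2 = 1" using u(3) by (simp add: power_mult_distrib)
  then have "b * r = - 1" using assms b by (simp add: power2_eq_1_iff) (smt (verit) mult_neg_pos)
  then have "b = - 1 / r" using assms by (simp add: field_simps)
  moreover from this have "b' = - ((cmod c)\<^sup>2 - r\<^sup>2) / r" "a = - c / of_real r"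
    using u(1,2) by (simp_all add: diff_divide_distrib)
  ultimately show "b = - 1 / r \<and> a = - c / of_real r \<and> b' = - ((cmod c)\<^sup>2 - r\<^sup>2) / r" by blast
next
  assume h: "b = - 1 / r \<and> a = - c / of_real r \<and> b' = - ((cmod c)\<^sup>2 - r\<^sup>2) / r"
  have "circle_points b' b a = Some ` sphere c r"
    using circle_points_sphere[OF assms, of "-1/r" c] assms h by (simp add: diff_divide_distrib)
  moreover have "b * b' = (norm a)\<^sup>2 - 1" unfolding h[THEN conjunct1] h[THEN conjunct2, THEN conjunct1]
      h[THEN conjunct2, THEN conjunct2] using assms
    by (simp add: norm_divide field_simps power2_eq_square)
  ultimately show "circle_coords (cw_circle c r) b' b a"
    unfolding circle_coords_def using h assms distinct_kinds by (auto simp: ccw_circle_def cw_circle_def)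
qed

lemma coords_line:
  assumes "cmod d = 1"
  shows "circle_coords (oriented_line p d) b' b a \<longleftrightarrow>
    b = 0 \<and> a = \<i> * d \<and> b' = 2 * Re (cnj a * p)"
proof -
  have d: "(Re d)\<^sup>2 + (Im d)\<^sup>2 = 1" using assms cmod_power2[of d] by simp
  show ?thesis
  proof
    assume h: "circle_coords (oriented_line p d) b' b a"
    then have b: "b = 0" using distinct_kinds unfolding circle_coords_def by (metis linorder_less_linear)
    have s: "circle_points b' b a = fst (oriented_line p d)" and e: "(cmod a)\<^sup>2 = 1"
      and i: "\<And>z. Some z \<in> fst (oriented_line p d) \<Longrightarrow> Some (z + a) \<in> snd (oriented_line p d)"
      using h b by (auto simp: circle_coords_def)
    have "p = p + of_real 0 * d" "p + d = p + of_real 1 * d" by auto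
    then have P: "Some p \<in> fst (oriented_line p d)" "Some (p + d) \<in> fst (oriented_line p d)"
      unfolding oriented_line_def fst_conv by blast+
    then have "circle_form b' b a p = 0" "circle_form b' b a (p + d) = 0"
      using s Some_circle_points by blast+
    then have f: "b' = 2 * (Re a * Re p + Im a * Im p)" "Re a * Re d + Im a * Im d = 0"
      by (auto simp: circle_form_def b algebra_simps)
    have pos: "Im a * Re d - Re a * Im d > 0" using i[OF P(1)]
      by (auto simp: oriented_line_def algebra_simps)
    let ?k = "Im a * Re d - Re a * Im d"
    have "?k\<^sup>2 + (Re a * Re d + Im a * Im d)\<^sup>2 = ((Re a)\<^sup>2 + (Im a)\<^sup>2) * ((Re d)\<^sup>2 + (Im d)\<^sup>2)"
      by (simp add: power2_eq_square algebra_simps)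
    then have "?k\<^sup>2 = 1" using f d e by (simp add: cmod_power2)
    then have k: "?k = 1" using pos by (simp add: power2_eq_1_iff)
    have "Re a = Re a * ((Re d)\<^sup>2 + (Im d)\<^sup>2)" "Im a = Im a * ((Re d)\<^sup>2 + (Im d)\<^sup>2)" by (auto simp: d)
    moreover have "Re a * ((Re d)\<^sup>2 + (Im d)\<^sup>2) = Re d * (Re a * Re d + Im a * Im d) - Im d * ?k"
      "Im a * ((Re d)\<^sup>2 + (Im d)\<^sup>2) = Im d * (Re a * Re d + Im a * Im d) + Re d * ?k"
      by (auto simp: power2_eq_square algebra_simps)
    ultimately have "Re a = Re d * 0 - Im d * 1" "Im a = Im d * 0 + Re d * 1" unfolding f k by argo+
    then have "Re a = - Im d" "Im a = Re d" by auto
    then have "a = \<i> * d" by (intro complex_eqI) auto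
    with b f show "b = 0 \<and> a = \<i> * d \<and> b' = 2 * Re (cnj a * p)" by simp
  next
    assume h: "b = 0 \<and> a = \<i> * d \<and> b' = 2 * Re (cnj a * p)"
    have form: "circle_form b' b a z = 2 * (Im d * (Re z - Re p) - Re d * (Im z - Im p))" for z
      using h by (simp add: circle_form_def algebra_simps)
    have z: "circle_form b' b a z = 0 \<longleftrightarrow> (\<exists>t. z = p + of_real t * d)" for z
    proof
      assume "circle_form b' b a z = 0"
      then have e: "Im d * (Re z - Re p) = Re d * (Im z - Im p)" by (simp add: form)
      let ?t = "Re d * (Re z - Re p) + Im d * (Im z - Im p)"
      have "?t * Re d = (Re d)\<^sup>2 * (Re z - Re p) + Im d * (Re d * (Im z - Im p))"
        by (simp add: power2_eq_square algebra_simps)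
      also have "\<dots> = ((Re d)\<^sup>2 + (Im d)\<^sup>2) * (Re z - Re p)"
        unfolding e[symmetric] by (simp add: power2_eq_square algebra_simps)
      finally have 1: "?t * Re d = Re z - Re p" by (simp add: d)
      have "?t * Im d = Re d * (Im d * (Re z - Re p)) + (Im d)\<^sup>2 * (Im z - Im p)"
        by (simp add: power2_eq_square algebra_simps)
      also have "\<dots> = ((Re d)\<^sup>2 + (Im d)\<^sup>2) * (Im z - Im p)"
        unfolding e by (simp add: power2_eq_square algebra_simps)
      finally have 2: "?t * Im d = Im z - Im p" by (simp add: d)
      have "z = p + of_real ?t * d" by (rule complex_eqI) (use 1 2 in auto)
      then show "\<exists>t. z = p + of_real t * d" by blast
    next
      assume "\<exists>t. z = p + of_real t * d"
      then show "circle_form b' b a z = 0" by (auto simp: form)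
    qed
    have fs: "fst (oriented_line p d) = circle_points b' b a"
    proof (rule Set.set_eqI)
      fix x show "x \<in> fst (oriented_line p d) \<longleftrightarrow> x \<in> circle_points b' b a"
        proof (cases x)
          case None then show ?thesis using h by (simp add: oriented_line_def None_circle_points)
        next
          case (Some y)
          have "Some y \<in> fst (oriented_line p d) \<longleftrightarrow> (\<exists>t. y = p + of_real t * d)"
            by (auto simp: oriented_line_def)
          then show ?thesis unfolding Some Some_circle_points z .
        qed
    qed
    have int: "Some (x + a) \<in> snd (oriented_line p d)" if x: "Some x \<in> fst (oriented_line p d)" for x
    proof -
      obtain t where "x = p + of_real t * d" using x by (auto simp: oriented_line_def)
      then have "Im ((x + a - p) * cnj d) = (Re d)\<^sup>2 + (Im d)\<^sup>2"
        using h by (simp add: power2_eq_square algebra_simps)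
      then show ?thesis by (simp add: oriented_line_def d)
    qed
    have "b * b' = (norm a)\<^sup>2 - 1" using h assms by (simp add: norm_mult)
    with fs int h distinct_kinds show "circle_coords (oriented_line p d) b' b a"
      unfolding circle_coords_def by auto
  qed
qed

lemma circle_coords_unique:
  assumes "oriented_circle C"
  shows "\<exists>b' b a. \<forall>b1' b1 a1. circle_coords C b1' b1 a1 \<longleftrightarrow> b1' = b' \<and> b1 = b \<and> a1 = a"
  using assms unfolding oriented_circle_def
proof (elim disjE exE conjE)
  fix c r assume "r > 0" "C = ccw_circle c r"
  then show ?thesis using coords_ccw[of r c] by auto
next
  fix c r assume "r > 0" "C = cw_circle c r"
  then show ?thesis using coords_cw[of r c] by auto
next
  fix p d assume "cmod d = 1" "C = oriented_line p d"
  then show ?thesis using coords_line[of d p] by auto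
qed

lemma circle_vec_eq:
  assumes "oriented_circle C" "circle_coords C b' b a"
  shows "circle_vec C = vector [b', b, Re a, Im a]"
proof -
  have "circle_coords C c' c e \<longleftrightarrow> c' = b' \<and> c = b \<and> e = a" for c' c e
    using circle_coords_unique[OF assms(1)] assms(2) by metis
  then show ?thesis unfolding circle_vec_def by (intro the_equality) auto
qed

section \<open>Bianchi circles\<close>

definition Z_sqrt_m2 :: "complex set" where
  "Z_sqrt_m2 = {of_int x + of_int y * csqrt (-2) | x y. True}"

definition extended_reals :: "riemann_sphere set" where
  "extended_reals = insert None (Some ` \<real>)"

fun moebius :: "complex^2^2 \<Rightarrow> riemann_sphere \<Rightarrow> riemann_sphere" where
  "moebius M (Some z) = quot_pt (M$1$1 * z + M$1$2) (M$2$1 * z + M$2$2)"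
| "moebius M None = quot_pt (M$1$1) (M$2$1)"

(* Elements of PSL are represented by matrices in SL; M and -M act alike. *)
definition bianchi_circle :: "riemann_sphere set \<Rightarrow> bool" where
  "bianchi_circle S \<longleftrightarrow>
    (\<exists>M :: complex^2^2. (\<forall>i j. M$i$j \<in> Z_sqrt_m2) \<and> det M = 1 \<and> S = moebius M ` extended_reals)"

(* Both orientations of a Bianchi circle are admitted. *)
definition oriented_bianchi_circle :: "ocircle \<Rightarrow> bool" where
  "oriented_bianchi_circle C \<longleftrightarrow> oriented_circle C \<and> bianchi_circle (fst C)"

section \<open>Cubes and the cube graph\<close>

definition cube_gram :: "real list list" where
  "cube_gram =
    [[ 1, -1, -3, -1, -5, -3, -1, -3],
     [-1,  1, -1, -3, -3, -5, -3, -1],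
     [-3, -1,  1, -1, -1, -3, -5, -3],
     [-1, -3, -1,  1, -3, -1, -3, -5],
     [-5, -3, -1, -3,  1, -1, -3, -1],
     [-3, -5, -3, -1, -1,  1, -1, -3],
     [-1, -3, -5, -3, -3, -1,  1, -1],
     [-3, -1, -3, -5, -1, -3, -1,  1]]"

(* The circle C_i of the tuple is the list entry i - 1. *)
definition is_cube :: "ocircle list \<Rightarrow> bool" where
  "is_cube Cs \<longleftrightarrow> length Cs = 8 \<and> (\<forall>i<8. oriented_bianchi_circle (Cs ! i)) \<and>
     (\<forall>i<8. \<forall>j<8. pedoe (circle_vec (Cs ! i)) (circle_vec (Cs ! j)) = cube_gram ! i ! j)"

definition side_indices :: "nat set set" where
  "side_indices =
    {{1, 2, 3, 4}, {5, 6, 7, 8}, {1, 2, 8, 7}, {2, 3, 5, 8}, {3, 4, 6, 5}, {1, 4, 6, 7}}"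

definition cube_sides :: "ocircle list \<Rightarrow> ocircle set set" where
  "cube_sides Cs = {(\<lambda>i. Cs ! (i - 1)) ` I | I. I \<in> side_indices}"

definition cube_vertices :: "ocircle set set" where
  "cube_vertices = {set Cs | Cs. is_cube Cs}"

definition cube_edges :: "ocircle set set set" where
  "cube_edges = {{set Cs, set Ds} | Cs Ds. is_cube Cs \<and> is_cube Ds \<and> set Cs \<noteq> set Ds \<and>
     cube_sides Cs \<inter> cube_sides Ds \<noteq> {}}"

(* Simple undirected graphs are given by a set of vertices and a set of two-element edges. *)
definition valence :: "'v set set \<Rightarrow> 'v \<Rightarrow> nat" where
  "valence E v = card {e \<in> E. v \<in> e}"

definition is_cycle :: "'v set set \<Rightarrow> 'v list \<Rightarrow> bool" where
  "is_cycle E vs \<longleftrightarrow> length vs \<ge> 3 \<and> distinct vs \<and>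
     (\<forall>i<length vs. {vs ! i, vs ! (Suc i mod length vs)} \<in> E)"

definition forest :: "'v set \<Rightarrow> 'v set set \<Rightarrow> bool" where
  "forest V E \<longleftrightarrow> (\<forall>e\<in>E. e \<subseteq> V \<and> card e = 2) \<and> (\<nexists>vs. is_cycle E vs)"

section \<open>Free products\<close>

definition fp_words :: "'i set \<Rightarrow> ('i \<Rightarrow> ('a, 'b) monoid_scheme) \<Rightarrow> ('i \<times> 'a) list set" where
  "fp_words I G = lists (SIGMA i:I. carrier (G i))"

(* The congruence on words generated by dropping identity letters and by multiplying
   adjacent letters from the same factor. *)
inductive fp_eq :: "'i set \<Rightarrow> ('i \<Rightarrow> ('a, 'b) monoid_scheme) \<Rightarrow>
    ('i \<times> 'a) list \<Rightarrow> ('i \<times> 'a) list \<Rightarrow> bool" for I G where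
  refl: "u \<in> fp_words I G \<Longrightarrow> fp_eq I G u u"
| sym: "fp_eq I G u v \<Longrightarrow> fp_eq I G v u"
| trans: "fp_eq I G u v \<Longrightarrow> fp_eq I G v w \<Longrightarrow> fp_eq I G u w"
| one: "u \<in> fp_words I G \<Longrightarrow> v \<in> fp_words I G \<Longrightarrow> i \<in> I \<Longrightarrow>
    fp_eq I G (u @ [(i, \<one>\<^bsub>G i\<^esub>)] @ v) (u @ v)"
| mult: "u \<in> fp_words I G \<Longrightarrow> v \<in> fp_words I G \<Longrightarrow> i \<in> I \<Longrightarrow>
    x \<in> carrier (G i) \<Longrightarrow> y \<in> carrier (G i) \<Longrightarrow>
    fp_eq I G (u @ [(i, x), (i, y)] @ v) (u @ [(i, x \<otimes>\<^bsub>G i\<^esub> y)] @ v)"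

definition fp_rel :: "'i set \<Rightarrow> ('i \<Rightarrow> ('a, 'b) monoid_scheme) \<Rightarrow>
    (('i \<times> 'a) list \<times> ('i \<times> 'a) list) set" where
  "fp_rel I G = {(u, v). fp_eq I G u v}"

definition free_product :: "'i set \<Rightarrow> ('i \<Rightarrow> ('a, 'b) monoid_scheme) \<Rightarrow>
    ('i \<times> 'a) list set monoid" where
  "free_product I G =
    \<lparr>carrier = fp_words I G // fp_rel I G,
     monoid.mult = (\<lambda>A B. \<Union>u\<in>A. \<Union>v\<in>B. fp_rel I G `` {u @ v}),
     one = fp_rel I G `` {[]}\<rparr>"

definition fp_incl :: "'i set \<Rightarrow> ('i \<Rightarrow> ('a, 'b) monoid_scheme) \<Rightarrow> 'i \<Rightarrow> 'a \<Rightarrow>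
    ('i \<times> 'a) list set" where
  "fp_incl I G i x = fp_rel I G `` {[(i, x)]}"

lemma fp_eq_words: "fp_eq I G u v \<Longrightarrow> (\<And>i. i \<in> I \<Longrightarrow> monoid (G i)) \<Longrightarrow> u \<in> fp_words I G \<and> v \<in> fp_words I G"
proof (induction rule: fp_eq.induct)
  case (one u v i)
  then have "\<one>\<^bsub>G i\<^esub> \<in> carrier (G i)" by (simp add: monoid.one_closed)
  with one show ?case by (auto simp: fp_words_def)
next
  case (mult u v i x y)
  then have "x \<otimes>\<^bsub>G i\<^esub> y \<in> carrier (G i)" by (simp add: monoid.m_closed)
  with mult show ?case by (auto simp: fp_words_def)
qed auto

lemma fp_eq_append_left:
  assumes "fp_eq I G u v" "w \<in> fp_words I G"
  shows "fp_eq I G (w @ u) (w @ v)"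
  using assms
proof (induction rule: fp_eq.induct)
  case (refl u) then show ?case by (intro fp_eq.refl) (auto simp: fp_words_def)
next
  case (sym u v) then show ?case by (simp add: fp_eq.sym)
next
  case (trans u v x) then show ?case by (metis fp_eq.trans)
next
  case (one u v i)
  then show ?case using fp_eq.one[of "w @ u" I G v i] by (auto simp: fp_words_def)
next
  case (mult u v i x y)
  then show ?case using fp_eq.mult[of "w @ u" I G v i x y] by (auto simp: fp_words_def)
qed

lemma fp_eq_append_right:
  assumes "fp_eq I G u v" "w \<in> fp_words I G"
  shows "fp_eq I G (u @ w) (v @ w)"
  using assms
proof (induction rule: fp_eq.induct)
  case (refl u) then show ?case by (intro fp_eq.refl) (auto simp: fp_words_def)
next
  case (sym u v) then show ?case by (simp add: fp_eq.sym)
next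
  case (trans u v x) then show ?case by (metis fp_eq.trans)
next
  case (one u v i)
  then show ?case using fp_eq.one[of u I G "v @ w" i] by (auto simp: fp_words_def)
next
  case (mult u v i x y)
  then show ?case using fp_eq.mult[of u I G "v @ w" i x y] by (auto simp: fp_words_def)
qed

lemma equiv_fp_rel:
  assumes "\<And>i. i \<in> I \<Longrightarrow> monoid (G i)"
  shows "equiv (fp_words I G) (fp_rel I G)"
proof (rule equivI)
  show "fp_rel I G \<subseteq> fp_words I G \<times> fp_words I G"
    using fp_eq_words[of I G, OF _ assms] by (auto simp: fp_rel_def)
  show "refl_on (fp_words I G) (fp_rel I G)"
    by (rule refl_onI) (simp add: fp_rel_def fp_eq.refl)
  show "Relation.sym (fp_rel I G)" by (rule symI) (simp add: fp_rel_def fp_eq.sym)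
  show "Relation.trans (fp_rel I G)" by (rule transI) (unfold fp_rel_def mem_Collect_eq prod.case, rule fp_eq.trans)
qed

lemma free_product_mult:
  assumes m: "\<And>i. i \<in> I \<Longrightarrow> monoid (G i)" and u: "u \<in> fp_words I G" and v: "v \<in> fp_words I G"
  shows "fp_rel I G `` {u} \<otimes>\<^bsub>free_product I G\<^esub> fp_rel I G `` {v} = fp_rel I G `` {u @ v}"
proof -
  have "congruent2 (fp_rel I G) (fp_rel I G) (\<lambda>u v. fp_rel I G `` {u @ v})"
  proof (rule congruent2I')
    fix y1 z1 y2 z2 assume "(y1, z1) \<in> fp_rel I G" "(y2, z2) \<in> fp_rel I G"
    then have h: "fp_eq I G y1 z1" "fp_eq I G y2 z2" by (auto simp: fp_rel_def)
    have "fp_eq I G (y1 @ y2) (z1 @ y2)" using h fp_eq_words[of I G, OF h(2) m] by (auto intro: fp_eq_append_right)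
    moreover have "fp_eq I G (z1 @ y2) (z1 @ z2)" using h fp_eq_words[of I G, OF h(1) m] by (auto intro: fp_eq_append_left)
    ultimately have "(y1 @ y2, z1 @ z2) \<in> fp_rel I G" unfolding fp_rel_def mem_Collect_eq prod.case by (rule fp_eq.trans)
    then show "fp_rel I G `` {y1 @ y2} = fp_rel I G `` {z1 @ z2}"
      using equiv_class_eq[OF equiv_fp_rel[of I G, OF m]] by blast
  qed
  from UN_equiv_class2[OF equiv_fp_rel[of I G, OF m] equiv_fp_rel[of I G, OF m] this u v] show ?thesis
    by (simp add: free_product_def)
qed

lemma group_free_product:
  assumes g: "\<And>i. i \<in> I \<Longrightarrow> group (G i)"
  shows "group (free_product I G)"
proof -
  have m: "\<And>i. i \<in> I \<Longrightarrow> monoid (G i)" using g group.is_monoid by blast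
  let ?c = "\<lambda>u. fp_rel I G `` {u}" and ?F = "free_product I G"
  have car: "A \<in> carrier ?F \<longleftrightarrow> (\<exists>u\<in>fp_words I G. A = ?c u)" for A
    by (auto simp: free_product_def quotient_def)
  have one: "\<one>\<^bsub>?F\<^esub> = ?c []" by (simp add: free_product_def)
  have nil: "[] \<in> fp_words I G" by (simp add: fp_words_def)
  have app: "u @ v \<in> fp_words I G" if "u \<in> fp_words I G" "v \<in> fp_words I G" for u v
    using that by (simp add: fp_words_def)
  note mult = free_product_mult[of I G, OF m]
  have inv: "\<exists>v\<in>fp_words I G. ?c (v @ u) = ?c []" if "u \<in> fp_words I G" for u
    using that
  proof (induction u)
    case Nil then show ?case using nil by auto
  next
    case (Cons p u)
    obtain i x where p: "p = (i, x)" by force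
    from Cons.prems have ix: "i \<in> I" "x \<in> carrier (G i)" and u: "u \<in> fp_words I G"
      by (auto simp: fp_words_def p)
    from Cons.IH[OF u] obtain v where v: "v \<in> fp_words I G" "?c (v @ u) = ?c []" by blast
    let ?y = "inv\<^bsub>G i\<^esub> x"
    have y: "?y \<in> carrier (G i)" "?y \<otimes>\<^bsub>G i\<^esub> x = \<one>\<^bsub>G i\<^esub>"
      using g[OF ix(1)] ix(2) by (auto simp: group.l_inv)
    have "fp_eq I G (v @ [(i, ?y), (i, x)] @ u) (v @ [(i, ?y \<otimes>\<^bsub>G i\<^esub> x)] @ u)"
      using v u ix y by (intro fp_eq.mult) auto
    moreover have "fp_eq I G (v @ [(i, ?y \<otimes>\<^bsub>G i\<^esub> x)] @ u) (v @ u)"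
      unfolding y(2) using v u ix by (intro fp_eq.one) auto
    ultimately have "(v @ [(i, ?y), (i, x)] @ u, v @ u) \<in> fp_rel I G"
      unfolding fp_rel_def mem_Collect_eq prod.case by (rule fp_eq.trans)
    then have "?c (v @ [(i, ?y), (i, x)] @ u) = ?c (v @ u)"
      using equiv_class_eq[OF equiv_fp_rel[of I G, OF m]] by blast
    moreover have "v @ [(i, ?y)] \<in> fp_words I G" using v ix y by (auto simp: fp_words_def)
    ultimately show ?case using v(2) by (intro bexI[of _ "v @ [(i, ?y)]"]) (auto simp: p)
  qed
  show ?thesis
  proof (rule groupI)
    fix A B assume "A \<in> carrier ?F" "B \<in> carrier ?F"
    then show "A \<otimes>\<^bsub>?F\<^esub> B \<in> carrier ?F" using mult app by (auto simp: car)
  next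
    show "\<one>\<^bsub>?F\<^esub> \<in> carrier ?F" using nil by (auto simp: car one)
  next
    fix A B C assume "A \<in> carrier ?F" "B \<in> carrier ?F" "C \<in> carrier ?F"
    then show "A \<otimes>\<^bsub>?F\<^esub> B \<otimes>\<^bsub>?F\<^esub> C = A \<otimes>\<^bsub>?F\<^esub> (B \<otimes>\<^bsub>?F\<^esub> C)"
      using mult app by (auto simp: car)
  next
    fix A assume "A \<in> carrier ?F"
    then show "\<one>\<^bsub>?F\<^esub> \<otimes>\<^bsub>?F\<^esub> A = A" using mult nil by (auto simp: car one)
  next
    fix A assume "A \<in> carrier ?F"
    then obtain u where u: "u \<in> fp_words I G" "A = ?c u" by (auto simp: car)
    with inv obtain v where "v \<in> fp_words I G" "?c (v @ u) = ?c []" by blast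
    then show "\<exists>B\<in>carrier ?F. B \<otimes>\<^bsub>?F\<^esub> A = \<one>\<^bsub>?F\<^esub>"
      using mult u by (intro bexI[of _ "?c v"]) (auto simp: car one)
  qed
qed

lemma fp_incl_hom:
  assumes g: "\<And>i. i \<in> I \<Longrightarrow> group (G i)" and i: "i \<in> I"
  shows "fp_incl I G i \<in> hom (G i) (free_product I G)"
proof -
  have m: "\<And>i. i \<in> I \<Longrightarrow> monoid (G i)" using g group.is_monoid by blast
  have w: "[(i, x)] \<in> fp_words I G" if "x \<in> carrier (G i)" for x using that i by (auto simp: fp_words_def)
  show ?thesis
  proof (rule homI)
    fix x assume "x \<in> carrier (G i)"
    then show "fp_incl I G i x \<in> carrier (free_product I G)"
      using w by (auto simp: free_product_def fp_incl_def intro: quotientI)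
  next
    fix x y assume xy: "x \<in> carrier (G i)" "y \<in> carrier (G i)"
    have "fp_eq I G ([] @ [(i, x), (i, y)] @ []) ([] @ [(i, x \<otimes>\<^bsub>G i\<^esub> y)] @ [])"
      using xy i by (intro fp_eq.mult) (auto simp: fp_words_def)
    then have "([(i, x), (i, y)], [(i, x \<otimes>\<^bsub>G i\<^esub> y)]) \<in> fp_rel I G"
      by (simp add: fp_rel_def)
    then have "fp_rel I G `` {[(i, x), (i, y)]} = fp_rel I G `` {[(i, x \<otimes>\<^bsub>G i\<^esub> y)]}"
      using equiv_class_eq[OF equiv_fp_rel[of I G, OF m]] by blast
    then show "fp_incl I G i (x \<otimes>\<^bsub>G i\<^esub> y) =
        fp_incl I G i x \<otimes>\<^bsub>free_product I G\<^esub> fp_incl I G i y"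
      unfolding fp_incl_def using free_product_mult[of I G, OF m w w] xy by simp
  qed
qed

section \<open>The six matrices\<close>

definition GL :: "(real^'n^'n) monoid" where
  "GL = \<lparr>carrier = {A. invertible A}, monoid.mult = (**), one = mat 1\<rparr>"

lemma group_GL: "group (GL :: (real^'n^'n) monoid)"
proof (rule groupI)
  fix A B :: "real^'n^'n" assume "A \<in> carrier GL" "B \<in> carrier GL"
  then show "A \<otimes>\<^bsub>GL\<^esub> B \<in> carrier GL" by (auto simp: GL_def invertible_mult)
next
  fix A B C :: "real^'n^'n"
  show "A \<otimes>\<^bsub>GL\<^esub> B \<otimes>\<^bsub>GL\<^esub> C = A \<otimes>\<^bsub>GL\<^esub> (B \<otimes>\<^bsub>GL\<^esub> C)"
    by (simp add: GL_def matrix_mul_assoc)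
next
  fix A :: "real^'n^'n" assume "A \<in> carrier GL"
  then show "\<exists>B\<in>carrier GL. B \<otimes>\<^bsub>GL\<^esub> A = \<one>\<^bsub>GL\<^esub>"
    unfolding GL_def invertible_def by auto
qed (auto simp: GL_def invertible_def)

definition cube_matrices :: "(real^4^4) list" where
  "cube_matrices =
    [vector [vector [1, 0, 3, 3],
             vector [0, 1, 3, 3],
             vector [0, 0, 0, -1],
             vector [0, 0, -1, 0]],
     vector [vector [1, 3, 0, 3],
             vector [0, 0, 0, -1],
             vector [0, 3, 1, 3],
             vector [0, -1, 0, 0]],
     vector [vector [0, 0, 0, -1],
             vector [3, 1, 0, 3],
             vector [3, 0, 1, 3],
             vector [-1, 0, 0, 0]],
     vector [vector [1, 3, 3, 0],
             vector [0, 0, -1, 0],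
             vector [0, -1, 0, 0],
             vector [0, 3, 3, 1]],
     vector [vector [0, 0, -1, 0],
             vector [3, 1, 3, 0],
             vector [-1, 0, 0, 0],
             vector [3, 0, 3, 1]],
     vector [vector [0, -1, 0, 0],
             vector [-1, 0, 0, 0],
             vector [3, 3, 1, 0],
             vector [3, 3, 0, 1]]]"

definition cube_group :: "(real^4^4) monoid" where
  "cube_group = subgroup_generated GL (set cube_matrices)"

end

theory Submission
  imports Defs
begin

text \<open>The Pedoe product has signature (3,1). A cube is an orthogonal frame \<open>m, f, p, q\<close> with
  \<open>\<langle>m, m\<rangle> = -2\<close> and unit vectors \<open>f, p, q\<close>: its eight circles are \<open>m \<plusminus> f \<plusminus> p \<plusminus> q\<close>, and its sides lie in
  the hyperplanes orthogonal to \<open>m + 2 g\<close> for \<open>g = \<plusminus>f, \<plusminus>p, \<plusminus>q\<close>. Exactly two cubes share a given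
  side, and reflection in its hyperplane exchanges them. The normals have norm 2 and mutual products
  \<open>-2\<close> or \<open>-6\<close>, so that distinct hyperplanes are parallel or ultraparallel: a path
  that does not turn back crosses each hyperplane away from its starting point, and hence never
  closes up. The same ping-pong argument applied to row vectors shows that no reduced word in
  the six matrices is the identity. Oriented Bianchi circles correspond to the vectors of norm 1 in a
  coset of a lattice, by a Euclidean descent, whence reflected cubes consist of Bianchi circles.\<close>

section \<open>Free products of groups of order two\<close>

text \<open>The two ping-pong arguments are one. The columns C_1, C_3, C_6, C_8 are alternate
  vertices of the cube, two on each face; they sum to 4 m, and 3 times the two on the face in
  direction g minus the other two is 4 (m + 2 g). So if the entries of the row \<open>y\<close> are
  minus the Pedoe products of a vector u with these columns, then \<open>entry_sum y\<close> is 4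
  times the height -<u, m>, and \<open>excess y k\<close> is 4 times the value of
  \<open>wall\<close> at the face whose two columns matrix \<open>k\<close> fixes. The starting row
  (1, 1, 1, 1) belongs to u = m / 2. The arithmetic obstacle is to see that a reflected vertex is
  again a Bianchi circle: reflection preserves products, but says nothing about matrices in SL2. The
  criterion is a congruence. The descent proving the converse rests on the Euclidean bound 1/4 + 2/4
  < 1 for the ring of integers.\<close>

abbreviation Z2_words :: "'i set \<Rightarrow> ('i \<times> int) list set" where
  "Z2_words I \<equiv> fp_words I (\<lambda>_. integer_mod_group 2)"

abbreviation Z2_eq :: "'i set \<Rightarrow> ('i \<times> int) list \<Rightarrow> ('i \<times> int) list \<Rightarrow> bool" where
  "Z2_eq I \<equiv> fp_eq I (\<lambda>_. integer_mod_group 2)"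

abbreviation Z2_rel :: "'i set \<Rightarrow> (('i \<times> int) list \<times> ('i \<times> int) list) set" where
  "Z2_rel I \<equiv> fp_rel I (\<lambda>_. integer_mod_group 2)"

abbreviation Z2_product :: "'i set \<Rightarrow> ('i \<times> int) list set monoid" where
  "Z2_product I \<equiv> free_product I (\<lambda>_. integer_mod_group 2)"

lemma carrier_Z2: "carrier (integer_mod_group 2) = {0, 1}"
  by (auto simp: carrier_integer_mod_group)

lemma Cons_mem_Z2_words: "(i, e) # u \<in> Z2_words I \<longleftrightarrow> i \<in> I \<and> (e = 0 \<or> e = 1) \<and> u \<in> Z2_words I"
  by (auto simp: fp_words_def carrier_Z2)

lemma Z2_eq_drop_zero:
  assumes "i \<in> I" "u \<in> Z2_words I"
  shows "Z2_eq I ((i, 0) # u) u"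
  using fp_eq.one[of "[]" I "\<lambda>_. integer_mod_group 2" u i] assms by (auto simp: fp_words_def)

lemma Z2_eq_cancel:
  assumes "i \<in> I" "u \<in> Z2_words I"
  shows "Z2_eq I ((i, 1) # (i, 1) # u) u"
proof -
  have "Z2_eq I ((i, 1) # (i, 1) # u) ((i, 0) # u)"
    using fp_eq.mult[of "[]" I "\<lambda>_. integer_mod_group 2" u i 1 1] assms
    by (auto simp: fp_words_def carrier_Z2)
  then show ?thesis using Z2_eq_drop_zero[OF assms] fp_eq.trans by metis
qed

text \<open>A letter put before a reduced word keeps it reduced unless it meets its own copy, and
  then the pair cancels. That different reduced words stay different is left to evaluation in a
  concrete group, see \<open>free_product_iso\<close>.\<close>

lemma Z2_eq_reduced_word:
  assumes "u \<in> Z2_words I"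
  shows "\<exists>ks. set ks \<subseteq> I \<and> distinct_adj ks \<and> Z2_eq I u (map (\<lambda>k. (k, 1)) ks)"
  using assms
proof (induction u)
  case Nil
  then show ?case by (intro exI[of _ "[]"]) (auto intro: fp_eq.refl)
next
  case (Cons p u)
  obtain i e where p: "p = (i, e)" by force
  have i: "i \<in> I" and e: "e = 0 \<or> e = 1" and u: "u \<in> Z2_words I"
    using Cons.prems by (auto simp: p Cons_mem_Z2_words)
  obtain ks where ks: "set ks \<subseteq> I" "distinct_adj ks" and eq: "Z2_eq I u (map (\<lambda>k. (k, 1)) ks)"
    using Cons.IH[OF u] by blast
  have "[p] \<in> Z2_words I" using i e by (auto simp: p fp_words_def carrier_Z2)
  from fp_eq_append_left[OF eq this]
  have eq': "Z2_eq I (p # u) (p # map (\<lambda>k. (k, 1)) ks)" by simp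
  have w: "map (\<lambda>k. (k, 1)) js \<in> Z2_words I" if "set js \<subseteq> I" for js
    using that by (auto simp: fp_words_def carrier_Z2)
  consider "e = 0" | "e = 1" "ks \<noteq> []" "hd ks = i" | "e = 1" "ks = [] \<or> i \<noteq> hd ks"
    using e by blast
  then show ?case
  proof cases
    case 1
    then show ?thesis
      using fp_eq.trans[OF eq'[unfolded p 1] Z2_eq_drop_zero[OF i w[OF ks(1)]]] ks p by auto
  next
    case 2
    then obtain js where js: "ks = i # js" by (cases ks) auto
    then have "set js \<subseteq> I" "distinct_adj js" using ks distinct_adj_ConsD by auto
    moreover have "Z2_eq I ((i, 1) # u) ((i, 1) # (i, 1) # map (\<lambda>k. (k, 1)) js)"
      using eq' by (simp add: p 2 js)
    ultimately show ?thesis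
      using fp_eq.trans[OF _ Z2_eq_cancel[OF i w]] p 2 by blast
  next
    case 3
    then have "set (i # ks) \<subseteq> I" "distinct_adj (i # ks)" using ks i by (auto simp: distinct_adj_Cons)
    moreover have "Z2_eq I (p # u) (map (\<lambda>k. (k, 1)) (i # ks))" using eq' 3 p by simp
    ultimately show ?thesis by blast
  qed
qed

definition word_value :: "('h, 'b) monoid_scheme \<Rightarrow> ('i \<Rightarrow> 'h) \<Rightarrow> ('i \<times> int) list \<Rightarrow> 'h" where
  "word_value H x u = foldr (\<lambda>(i, e) a. (if e = 1 then x i else \<one>\<^bsub>H\<^esub>) \<otimes>\<^bsub>H\<^esub> a) u \<one>\<^bsub>H\<^esub>"

lemma word_value_Nil [simp]: "word_value H x [] = \<one>\<^bsub>H\<^esub>"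
  by (simp add: word_value_def)

lemma word_value_Cons [simp]:
  "word_value H x ((i, e) # u) = (if e = 1 then x i else \<one>\<^bsub>H\<^esub>) \<otimes>\<^bsub>H\<^esub> word_value H x u"
  by (simp add: word_value_def)

locale involutions = group H for H (structure) +
  fixes I :: "'i set" and x :: "'i \<Rightarrow> 'a"
  assumes mem: "i \<in> I \<Longrightarrow> x i \<in> carrier H"
    and square: "i \<in> I \<Longrightarrow> x i \<otimes> x i = \<one>"
begin

lemma word_value_closed: "u \<in> Z2_words I \<Longrightarrow> word_value H x u \<in> carrier H"
proof (induction u)
  case (Cons p u)
  then show ?case using mem by (cases p) (auto simp: Cons_mem_Z2_words)
qed simp

lemma word_value_append:
  assumes "u \<in> Z2_words I" "v \<in> Z2_words I"
  shows "word_value H x (u @ v) = word_value H x u \<otimes> word_value H x v"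
  using assms
proof (induction u)
  case Nil
  then show ?case using word_value_closed by simp
next
  case (Cons p u)
  then show ?case using mem word_value_closed
    by (cases p) (auto simp: Cons_mem_Z2_words m_assoc)
qed

text \<open>Dropping a zero letter is harmless because its value is one; among the products in Z/2
  only 1 + 1 = 0 needs an argument, and it is \<open>square\<close>.\<close>

lemma word_value_cong:
  assumes "Z2_eq I u v"
  shows "word_value H x u = word_value H x v"
  using assms
proof (induction rule: fp_eq.induct)
  case (one u v i)
  then have "(i, 0) # v \<in> Z2_words I" by (simp add: Cons_mem_Z2_words)
  with one show ?case using word_value_closed by (simp add: word_value_append)
next
  case (mult u v i y z)
  then have yz: "y = 0 \<or> y = 1" "z = 0 \<or> z = 1" by (auto simp: carrier_Z2)
  then have "(i, y) # (i, z) # v \<in> Z2_words I" "(i, (y + z) mod 2) # v \<in> Z2_words I"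
    using mult by (auto simp: Cons_mem_Z2_words)
  moreover have "x i \<otimes> (x i \<otimes> word_value H x v) = word_value H x v"
    using mult mem square word_value_closed by (simp flip: m_assoc)
  ultimately show ?case using mult yz word_value_closed mem by (auto simp: word_value_append)
qed auto

lemma generate_word_value:
  assumes "a \<in> generate H (x ` I)"
  shows "\<exists>u\<in>Z2_words I. a = word_value H x u"
  using assms
proof (induction rule: generate.induct)
  case one
  then show ?case by (intro bexI[of _ "[]"]) (auto simp: fp_words_def)
next
  case (incl a)
  then obtain i where "i \<in> I" "a = x i" by auto
  then show ?case using mem by (intro bexI[of _ "[(i, 1)]"]) (auto simp: fp_words_def carrier_Z2)
next
  case (inv a)
  then obtain i where i: "i \<in> I" "a = x i" by auto
  then have "inv a = x i" using mem square by (simp add: inv_equality)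
  then show ?case using i mem by (intro bexI[of _ "[(i, 1)]"]) (auto simp: fp_words_def carrier_Z2)
next
  case (eng a b)
  then obtain u v where "u \<in> Z2_words I" "v \<in> Z2_words I" "a = word_value H x u" "b = word_value H x v"
    by blast
  then show ?case by (intro bexI[of _ "u @ v"]) (auto simp: word_value_append fp_words_def)
qed

lemma word_value_generate: "u \<in> Z2_words I \<Longrightarrow> word_value H x u \<in> generate H (x ` I)"
proof (induction u)
  case Nil
  then show ?case by (simp add: generate.one)
next
  case (Cons p u)
  then show ?case
    by (cases p) (auto simp: Cons_mem_Z2_words intro: generate.eng[OF generate.incl] generate.eng[OF generate.one])
qed

text \<open>Evaluation descends to classes and reaches the whole generated subgroup. A word of value
  one is congruent to a reduced word, which \<open>reduced\<close> forces to be empty; so the kernel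
  is trivial.\<close>

lemma free_product_iso:
  assumes reduced: "\<And>ks. ks \<noteq> [] \<Longrightarrow> set ks \<subseteq> I \<Longrightarrow> distinct_adj ks \<Longrightarrow>
    word_value H x (map (\<lambda>k. (k, 1)) ks) \<noteq> \<one>"
  shows "\<exists>\<phi> \<in> iso (Z2_product I) (subgroup_generated H (x ` I)).
    \<forall>i\<in>I. \<phi> (fp_incl I (\<lambda>_. integer_mod_group 2) i 1) = x i"
proof -
  let ?F = "Z2_product I" and ?c = "\<lambda>u. Z2_rel I `` {u}" and ?S = "subgroup_generated H (x ` I)"
  have m: "\<And>i. i \<in> I \<Longrightarrow> monoid (integer_mod_group 2)" by (simp add: group.is_monoid)
  have equiv: "equiv (Z2_words I) (Z2_rel I)" by (rule equiv_fp_rel[of I "\<lambda>_. integer_mod_group 2", OF m])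
  define \<phi> where "\<phi> A = the_elem (word_value H x ` A)" for A
  have \<phi>: "\<phi> (?c u) = word_value H x u" if "u \<in> Z2_words I" for u
  proof -
    have "u \<in> ?c u" using that by (simp add: fp_rel_def fp_eq.refl)
    moreover have "word_value H x v = word_value H x u" if "v \<in> ?c u" for v
      using that word_value_cong[of u v] by (simp add: fp_rel_def)
    ultimately have "word_value H x ` ?c u = {word_value H x u}" by blast
    then show ?thesis by (simp add: \<phi>_def)
  qed
  have car: "A \<in> carrier ?F \<longleftrightarrow> (\<exists>u\<in>Z2_words I. A = ?c u)" for A
    by (auto simp: free_product_def quotient_def)
  have carS: "carrier ?S = generate H (x ` I)"
    using mem by (simp add: carrier_subgroup_generated) (metis Int_absorb1 image_subsetI)
  have S: "group ?S" by simp
  have F: "group ?F" by (rule group_free_product) simp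
  have hom: "\<phi> \<in> hom ?F ?S"
  proof (rule homI)
    fix A assume "A \<in> carrier ?F"
    then show "\<phi> A \<in> carrier ?S" using \<phi> word_value_generate by (auto simp: car carS)
  next
    fix A B assume "A \<in> carrier ?F" "B \<in> carrier ?F"
    then obtain u v where uv: "u \<in> Z2_words I" "v \<in> Z2_words I" "A = ?c u" "B = ?c v"
      by (auto simp: car)
    then have "u @ v \<in> Z2_words I" by (auto simp: fp_words_def)
    with uv show "\<phi> (A \<otimes>\<^bsub>?F\<^esub> B) = \<phi> A \<otimes>\<^bsub>?S\<^esub> \<phi> B"
      using free_product_mult[of I "\<lambda>_. integer_mod_group 2", OF m uv(1,2)]
      by (simp add: \<phi> word_value_append)
  qed
  interpret \<phi>: group_hom ?F ?S \<phi>
    using F S hom by (simp add: group_hom_def group_hom_axioms_def)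
  have "kernel ?F ?S \<phi> = {\<one>\<^bsub>?F\<^esub>}"
  proof
    show "kernel ?F ?S \<phi> \<subseteq> {\<one>\<^bsub>?F\<^esub>}"
    proof
      fix A assume "A \<in> kernel ?F ?S \<phi>"
      then obtain u where u: "u \<in> Z2_words I" "A = ?c u" "word_value H x u = \<one>"
        using \<phi> by (auto simp: kernel_def car)
      obtain ks where ks: "set ks \<subseteq> I" "distinct_adj ks" "Z2_eq I u (map (\<lambda>k. (k, 1)) ks)"
        using Z2_eq_reduced_word[OF u(1)] by blast
      then have "ks = []" using reduced[of ks] word_value_cong[of u] u(3) by auto
      with ks have "(u, []) \<in> Z2_rel I" by (simp add: fp_rel_def)
      then have "?c u = ?c []" by (rule equiv_class_eq[OF equiv])
      then show "A \<in> {\<one>\<^bsub>?F\<^esub>}" using u by (simp add: free_product_def)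
    qed
  qed (use \<phi>.hom_one in \<open>simp add: kernel_def\<close>)
  then have "inj_on \<phi> (carrier ?F)" by (rule \<phi>.trivial_ker_imp_inj)
  moreover have "\<phi> ` carrier ?F = carrier ?S"
  proof
    show "carrier ?S \<subseteq> \<phi> ` carrier ?F"
    proof
      fix a assume "a \<in> carrier ?S"
      then obtain u where "u \<in> Z2_words I" "a = word_value H x u"
        using generate_word_value carS by blast
      then show "a \<in> \<phi> ` carrier ?F" using \<phi>[of u] car by (metis image_eqI)
    qed
  qed (use \<phi>.hom_closed in auto)
  ultimately have "\<phi> \<in> iso ?F ?S" using hom by (simp add: iso_def bij_betw_def)
  moreover have "\<forall>i\<in>I. \<phi> (fp_incl I (\<lambda>_. integer_mod_group 2) i 1) = x i"
    using \<phi> mem by (auto simp: fp_incl_def Cons_mem_Z2_words fp_words_def carrier_Z2)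
  ultimately show ?thesis by blast
qed

end

section \<open>Ping-pong for the six matrices\<close>

text \<open>A word of matrices acts on row vectors \<open>y\<close>. The matrix \<open>k\<close> fixes two of the entries of
  \<open>y\<close>, and \<open>excess y k\<close> is half the amount by which it raises the sum of all entries.\<close>

definition excess :: "real^4 \<Rightarrow> nat \<Rightarrow> real" where
  "excess y k =
    [3 * (y$1 + y$2) - (y$3 + y$4), 3 * (y$1 + y$3) - (y$2 + y$4), 3 * (y$2 + y$3) - (y$1 + y$4),
     3 * (y$1 + y$4) - (y$2 + y$3), 3 * (y$2 + y$4) - (y$1 + y$3), 3 * (y$3 + y$4) - (y$1 + y$2)] ! k"

definition entry_sum :: "real^4 \<Rightarrow> real" where
  "entry_sum y = y$1 + y$2 + y$3 + y$4"

lemma less_6_cases: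
  assumes "(k::nat) < 6"
  obtains "k = 0" | "k = 1" | "k = 2" | "k = 3" | "k = 4" | "k = 5"
  using assms by (auto simp: less_Suc_eq numeral_eq_Suc)

lemma vector_matrix_4: "((y::real^4) v* A) $ j = y$1 * A$1$j + y$2 * A$2$j + y$3 * A$3$j + y$4 * A$4$j"
  by (simp add: vector_matrix_mult_def sum_4 mult.commute)

lemma entry_sum_step:
  assumes "k < 6"
  shows "entry_sum (y v* cube_matrices ! k) = entry_sum y + 2 * excess y k"
  using assms by (cases rule: less_6_cases)
    (simp_all add: entry_sum_def excess_def cube_matrices_def vector_matrix_4)

lemma excess_step_same:
  assumes "k < 6"
  shows "excess (y v* cube_matrices ! k) k = - excess y k"
  using assms by (cases rule: less_6_cases)
    (simp_all add: excess_def cube_matrices_def vector_matrix_4)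

text \<open>The list is ordered so that matrices \<open>k\<close> and \<open>5 - k\<close> fix
  complementary pairs of entries, that is, belong to opposite faces. The factors 6 and 2 are the
  negated products of the normals of opposite and of adjacent faces.\<close>

lemma excess_step_other:
  assumes "k < 6" "l < 6" "l \<noteq> k"
  shows "excess (y v* cube_matrices ! k) l = excess y l + (if k + l = 5 then 6 else 2) * excess y k"
  by (rule less_6_cases[OF assms(1)]; rule less_6_cases[OF assms(2)]; use assms(3) in
    \<open>simp add: excess_def cube_matrices_def vector_matrix_4\<close>)

text \<open>Along a reduced word, only the excess of the letter just read is negative, and it is
  outweighed by each of the others; hence the next letter raises the sum again.\<close>

lemma entry_sum_reduced_word:
  assumes "k < 6" "excess y k < 0" "\<And>l. l < 6 \<Longrightarrow> l \<noteq> k \<Longrightarrow> excess y l > - excess y k"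
    and "set ks \<subseteq> {..<6}" "distinct_adj (k # ks)"
  shows "entry_sum y \<le> entry_sum (y v* word_value GL ((!) cube_matrices) (map (\<lambda>k. (k, 1)) ks))"
  using assms
proof (induction ks arbitrary: k y)
  case Nil
  then show ?case by (simp add: GL_def)
next
  case (Cons j ks)
  let ?y = "y v* cube_matrices ! j"
  have j: "j < 6" "j \<noteq> k" using Cons.prems by auto
  then have pos: "excess y j > - excess y k" "excess y j > 0" using Cons.prems(2,3) by force+
  have "entry_sum y \<le> entry_sum ?y" using entry_sum_step[OF j(1)] pos by simp
  also have "\<dots> \<le> entry_sum (?y v* word_value GL ((!) cube_matrices) (map (\<lambda>k. (k, 1)) ks))"
  proof (rule Cons.IH[OF j(1)])
    show "excess ?y j < 0" using excess_step_same[OF j(1)] pos by simp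
    show "excess ?y l > - excess ?y j" if l: "l < 6" "l \<noteq> j" for l
    proof -
      \<comment> \<open>For \<open>l = k\<close> this is the bound on \<open>j\<close> read
        backwards; any other excess is already positive. The step adds at least twice the excess of
        \<open>j\<close>, which restores the strict bound.\<close>
      have "excess y l > - excess y j" using Cons.prems(2,3) l pos by (cases "l = k") force+
      then show ?thesis
        using excess_step_other[OF j(1) l] excess_step_same[OF j(1)] pos by (simp split: if_splits)
    qed
  qed (use Cons.prems in \<open>auto dest: distinct_adj_ConsD\<close>)
  finally show ?case by (simp add: GL_def vector_matrix_mul_assoc)
qed

lemma reduced_word_neq_one:
  assumes "ks \<noteq> []" "set ks \<subseteq> {..<6}" "distinct_adj ks"
  shows "word_value GL ((!) cube_matrices) (map (\<lambda>k. (k, 1)) ks) \<noteq> \<one>\<^bsub>GL\<^esub>"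
proof
  obtain j js where ks: "ks = j # js" using assms(1) by (cases ks) auto
  \<comment> \<open>On this symmetric row all six excesses agree and are positive, so any first
    letter raises the sum.\<close>
  let ?y = "vector [1, 1, 1, 1] :: real^4"
  let ?z = "?y v* cube_matrices ! j"
  have j: "j < 6" using assms ks by simp
  have e: "excess ?y l = 4" if "l < 6" for l
    using that by (cases rule: less_6_cases) (simp_all add: excess_def)
  have "entry_sum ?y < entry_sum ?z" using entry_sum_step[OF j] e[OF j] by simp
  also have "\<dots> \<le> entry_sum (?z v* word_value GL ((!) cube_matrices) (map (\<lambda>k. (k, 1)) js))"
  proof (rule entry_sum_reduced_word[OF j])
    show "excess ?z j < 0" using excess_step_same[OF j] e[OF j] by simp
    show "excess ?z l > - excess ?z j" if "l < 6" "l \<noteq> j" for l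
      using excess_step_other[OF j that] excess_step_same[OF j] e j that by (simp split: if_splits)
  qed (use assms ks in auto)
  also have "\<dots> = entry_sum (?y v* word_value GL ((!) cube_matrices) (map (\<lambda>k. (k, 1)) ks))"
    by (simp add: ks GL_def vector_matrix_mul_assoc)
  finally show False
    if "word_value GL ((!) cube_matrices) (map (\<lambda>k. (k, 1)) ks) = \<one>\<^bsub>GL\<^esub>"
    using that by (simp add: GL_def)
qed

lemma cube_matrix_square:
  assumes "k < 6"
  shows "cube_matrices ! k ** cube_matrices ! k = mat 1"
  using assms by (cases rule: less_6_cases)
    (simp_all add: cube_matrices_def matrix_matrix_mult_def vec_eq_iff forall_4 sum_4 mat_def)

lemma involutions_cube_matrices: "involutions GL {..<6} ((!) cube_matrices)"
proof (intro involutions.intro involutions_axioms.intro group_GL)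
  fix k :: nat assume k: "k \<in> {..<6}"
  then show "cube_matrices ! k \<otimes>\<^bsub>GL\<^esub> cube_matrices ! k = \<one>\<^bsub>GL\<^esub>"
    using cube_matrix_square by (simp add: GL_def)
  then show "cube_matrices ! k \<in> carrier GL" by (auto simp: GL_def invertible_def)
qed

lemma set_cube_matrices: "set cube_matrices = (!) cube_matrices ` {..<6}"
  by (auto simp: set_conv_nth cube_matrices_def)

lemma cube_group_iso:
  "\<exists>\<phi> \<in> iso (Z2_product {..<6::nat}) cube_group.
    \<forall>k\<in>{..<6}. \<phi> (fp_incl {..<6} (\<lambda>_. integer_mod_group 2) k 1) = cube_matrices ! k"
  unfolding cube_group_def set_cube_matrices
  by (rule involutions.free_product_iso[OF involutions_cube_matrices reduced_word_neq_one])

lemma ord_cube_matrix: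
  assumes k: "k < 6"
  shows "group.ord cube_group (cube_matrices ! k) = 2"
proof -
  interpret GL: group "GL :: (real^4^4) monoid" by (rule group_GL)
  interpret group cube_group unfolding cube_group_def by simp
  let ?M = "cube_matrices ! k"
  have "?M \<in> set cube_matrices" using k by (auto simp: set_cube_matrices)
  moreover have "?M \<in> carrier GL" using involutions.mem[OF involutions_cube_matrices] k by simp
  ultimately have M: "?M \<in> carrier cube_group"
    by (simp add: cube_group_def carrier_subgroup_generated generate.incl)
  have sq: "?M [^]\<^bsub>cube_group\<^esub> (2::nat) = \<one>\<^bsub>cube_group\<^esub>"
    using M cube_matrix_square[OF k] by (simp add: numeral_2_eq_2) (simp add: cube_group_def GL_def)
  have "?M \<noteq> \<one>\<^bsub>cube_group\<^esub>"
    using reduced_word_neq_one[of "[k]"] k by (auto simp: cube_group_def GL_def)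
  then have "ord ?M \<noteq> 1" using M ord_eq_1 by blast
  moreover have "ord ?M dvd 2" using sq M pow_eq_id by blast
  moreover have "ord ?M dvd 2 \<Longrightarrow> ord ?M = 1 \<or> ord ?M = 2"
    using dvd_imp_le[of "ord ?M" 2] by (cases "ord ?M = 0") auto
  ultimately show ?thesis by blast
qed

section \<open>Cubes as orthogonal frames for the Pedoe product\<close>

lemma pedoe_add_left [simp]: "pedoe (x + y) z = pedoe x z + pedoe y z"
  and pedoe_add_right [simp]: "pedoe z (x + y) = pedoe z x + pedoe z y"
  and pedoe_diff_left [simp]: "pedoe (x - y) z = pedoe x z - pedoe y z"
  and pedoe_diff_right [simp]: "pedoe z (x - y) = pedoe z x - pedoe z y"
  and pedoe_minus_left [simp]: "pedoe (- x) z = - pedoe x z"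
  and pedoe_minus_right [simp]: "pedoe z (- x) = - pedoe z x"
  and pedoe_scale_left [simp]: "pedoe (c *\<^sub>R x) z = c * pedoe x z"
  and pedoe_scale_right [simp]: "pedoe z (c *\<^sub>R x) = c * pedoe z x"
  and pedoe_zero [simp]: "pedoe 0 z = 0" "pedoe z 0 = 0"
  by (simp_all add: pedoe_def field_simps)

lemma pedoe_commute: "pedoe x y = pedoe y x"
  by (simp add: pedoe_def)

definition frame :: "real^4 \<Rightarrow> real^4 \<Rightarrow> real^4 \<Rightarrow> real^4 \<Rightarrow> bool" where
  "frame m f p q \<longleftrightarrow> pedoe m m = -2 \<and> pedoe f f = 1 \<and> pedoe p p = 1 \<and> pedoe q q = 1 \<and>
     pedoe m f = 0 \<and> pedoe m p = 0 \<and> pedoe m q = 0 \<and> pedoe f p = 0 \<and> pedoe f q = 0 \<and> pedoe p q = 0"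

lemma frameD:
  assumes "frame m f p q"
  shows "pedoe m m = -2" "pedoe f f = 1" "pedoe p p = 1" "pedoe q q = 1"
    "pedoe m f = 0" "pedoe m p = 0" "pedoe m q = 0" "pedoe f p = 0" "pedoe f q = 0" "pedoe p q = 0"
    "pedoe f m = 0" "pedoe p m = 0" "pedoe q m = 0" "pedoe p f = 0" "pedoe q f = 0" "pedoe q p = 0"
  using assms by (simp_all add: frame_def pedoe_commute[of f m] pedoe_commute[of p m]
    pedoe_commute[of q m] pedoe_commute[of p f] pedoe_commute[of q f] pedoe_commute[of q p])

lemma frame_rotate: "frame m f p q \<Longrightarrow> frame m p q f"
  unfolding frame_def by (simp add: pedoe_commute[of p f] pedoe_commute[of q f])

lemma frame_uminus: "frame m f p q \<Longrightarrow> frame m (- f) p q"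
  by (simp add: frame_def)

lemma pedoe_nondegenerate:
  assumes "\<And>x. pedoe z x = 0"
  shows "z = 0"
proof -
  have "pedoe z (axis i 1) = 0" for i using assms .
  from this[of 1] this[of 2] this[of 3] this[of 4] show ?thesis
    by (simp add: pedoe_def axis_def vec_eq_iff forall_4)
qed

text \<open>Orthogonal vectors of nonzero norm are independent, so the four span the space. From
  here on, two vectors are compared through their products with a frame.\<close>

lemma orthogonal_frame_eq_0:
  assumes f: "frame m f p q" and z: "pedoe z m = 0" "pedoe z f = 0" "pedoe z p = 0" "pedoe z q = 0"
  shows "z = 0"
proof (rule pedoe_nondegenerate)
  note d = frameD[OF f]
  let ?B = "{m, f, p, q}"
  have ne: "m \<noteq> f" "m \<noteq> p" "m \<noteq> q" "f \<noteq> p" "f \<noteq> q" "p \<noteq> q" using d by auto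
  have "independent ?B"
  proof (rule independent_if_scalars_zero)
    fix c :: "real^4 \<Rightarrow> real" and x
    assume s: "(\<Sum>x\<in>?B. c x *\<^sub>R x) = 0" and x: "x \<in> ?B"
    have "c m *\<^sub>R m + c f *\<^sub>R f + c p *\<^sub>R p + c q *\<^sub>R q = 0" using s ne by (simp add: add.assoc)
    then have "pedoe (c m *\<^sub>R m + c f *\<^sub>R f + c p *\<^sub>R p + c q *\<^sub>R q) y = 0" for y by simp
    from this[of m] this[of f] this[of p] this[of q] show "c x = 0" using x by (auto simp: d)
  qed simp
  moreover have "card ?B = 4" using ne by simp
  ultimately have "span ?B = UNIV"
    using card_ge_dim_independent[of ?B UNIV] by (auto simp: dim_UNIV)
  fix x
  have "x \<in> span ?B" using \<open>span ?B = UNIV\<close> by simp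
  then show "pedoe z x = 0"
    by (induction rule: span_induct_alt) (use z in auto)
qed

section \<open>Recovering centre, directions and faces from the vertex set of a cube\<close>

definition square :: "real^4 \<Rightarrow> real^4 \<Rightarrow> real^4 \<Rightarrow> (real^4) set" where
  "square c p q = {c + p + q, c + p - q, c - p + q, c - p - q}"

definition cube_points :: "real^4 \<Rightarrow> real^4 \<Rightarrow> real^4 \<Rightarrow> real^4 \<Rightarrow> (real^4) set" where
  "cube_points m f p q = square (m + f) p q \<union> square (m - f) p q"

lemma mem_cube_points:
  "x \<in> cube_points m f p q \<longleftrightarrow>
    (\<exists>a\<in>{1,-1}. \<exists>b\<in>{1,-1}. \<exists>c\<in>{1,-1}. x = m + a *\<^sub>R f + b *\<^sub>R p + c *\<^sub>R q)"
  by (auto simp: cube_points_def square_def)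

lemma cube_points_rotate: "cube_points m f p q = cube_points m p q f"
  unfolding cube_points_def square_def by (auto simp: algebra_simps)

lemma cube_points_uminus: "cube_points m (- f) p q = cube_points m f p q"
  unfolding cube_points_def square_def by auto

text \<open>Read off from the bare point set, since vertices of the graph are unordered sets and a
  cube has many frames. Product -1 marks the two ends of an edge; in \<open>center\<close>, product
  -5 marks antipodes.\<close>

definition directions :: "(real^4) set \<Rightarrow> (real^4) set" where
  "directions P = {(1/2) *\<^sub>R (v - w) | v w. v \<in> P \<and> w \<in> P \<and> pedoe v w = -1}"

definition center :: "(real^4) set \<Rightarrow> real^4" where
  "center P = (THE m. \<exists>v\<in>P. \<exists>w\<in>P. pedoe v w = -5 \<and> m = (1/2) *\<^sub>R (v + w))"

text \<open>For a direction \<open>g\<close> of the cube, \<open>pedoe v g\<close> is the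
  coefficient 1 or -1 of \<open>g\<close> in the vertex \<open>v\<close>.\<close>

definition face :: "(real^4) set \<Rightarrow> real^4 \<Rightarrow> (real^4) set" where
  "face P g = {v \<in> P. pedoe v g = 1}"

text \<open>Two vertices differing in d signs have product 1 - 2 d: the entries 1, -1, -3, -5 of
  \<open>cube_gram\<close> are distances in the graph of the cube.\<close>

lemma pedoe_cube_points:
  assumes "frame m f p q"
  shows "pedoe (m + a *\<^sub>R f + b *\<^sub>R p + c *\<^sub>R q) (m + a' *\<^sub>R f + b' *\<^sub>R p + c' *\<^sub>R q) =
    a * a' + b * b' + c * c' - 2"
  by (simp add: frameD[OF assms])

lemma directions_cube_points:
  assumes f: "frame m f p q"
  shows "directions (cube_points m f p q) = {f, - f, p, - p, q, - q}"
    (is "directions ?P = ?R")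
proof
  have half: "(1/2) *\<^sub>R ((m + a *\<^sub>R f + b *\<^sub>R p + c *\<^sub>R q) - (m + a' *\<^sub>R f + b' *\<^sub>R p + c' *\<^sub>R q)) =
      ((a - a') / 2) *\<^sub>R f + ((b - b') / 2) *\<^sub>R p + ((c - c') / 2) *\<^sub>R q" for a b c a' b' c'
    by (simp add: algebra_simps diff_divide_distrib)
  show "directions ?P \<subseteq> ?R"
  proof
    fix x assume "x \<in> directions ?P"
    then obtain v w where vw: "v \<in> ?P" "w \<in> ?P" "pedoe v w = -1" "x = (1/2) *\<^sub>R (v - w)"
      unfolding directions_def by blast
    then obtain a b c where s: "a \<in> {1,-1}" "b \<in> {1,-1}" "c \<in> {1,-1}"
      and v: "v = m + a *\<^sub>R f + b *\<^sub>R p + c *\<^sub>R q" unfolding mem_cube_points by blast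
    obtain a' b' c' where s': "a' \<in> {1,-1}" "b' \<in> {1,-1}" "c' \<in> {1,-1}"
      and w: "w = m + a' *\<^sub>R f + b' *\<^sub>R p + c' *\<^sub>R q" using vw(2) unfolding mem_cube_points by blast
    have sum: "a * a' + b * b' + c * c' = 1" using vw(3) unfolding v w pedoe_cube_points[OF f] by simp
    have one: "t * t' = 1 \<and> t' = t \<or> t * t' = -1 \<and> t' = - t" if "t \<in> {1,-1}" "t' \<in> {1,-1}" for t t' :: real
      using that by auto
    have "(a' = - a \<and> b' = b \<and> c' = c) \<or> (a' = a \<and> b' = - b \<and> c' = c) \<or> (a' = a \<and> b' = b \<and> c' = - c)"
      using sum one[OF s(1) s'(1)] one[OF s(2) s'(2)] one[OF s(3) s'(3)] by argo
    then show "x \<in> ?R" unfolding vw(4) v w half using s(1-3) by auto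
  qed
  show "?R \<subseteq> directions ?P"
  proof
    fix x assume "x \<in> ?R"
    moreover have mem: "x \<in> directions ?P" if "v \<in> ?P" "w \<in> ?P" "pedoe v w = -1" "x = (1/2) *\<^sub>R (v - w)" for v w
      using that unfolding directions_def by blast
    ultimately show "x \<in> directions ?P"
      using mem[of "m + f + p + q" "m - f + p + q"] mem[of "m - f + p + q" "m + f + p + q"]
        mem[of "m + f + p + q" "m + f - p + q"] mem[of "m + f - p + q" "m + f + p + q"]
        mem[of "m + f + p + q" "m + f + p - q"] mem[of "m + f + p - q" "m + f + p + q"]
      by (auto simp: cube_points_def square_def frameD[OF f] vec_eq_iff)
  qed
qed

lemma card_directions:
  assumes f: "frame m f p q"
  shows "card (directions (cube_points m f p q)) = 6"
proof -
  note d = frameD[OF f]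
  have "x \<noteq> y" if "pedoe x x \<noteq> pedoe x y" for x y :: "real^4" using that by auto
  then have "distinct [f, - f, p, - p, q, - q]" by (auto simp: d)
  from distinct_card[OF this] show ?thesis by (simp add: directions_cube_points[OF f])
qed

lemma center_cube_points:
  assumes f: "frame m f p q"
  shows "center (cube_points m f p q) = m"
  unfolding center_def
proof (rule the_equality)
  show "\<exists>v\<in>cube_points m f p q. \<exists>w\<in>cube_points m f p q. pedoe v w = -5 \<and> m = (1/2) *\<^sub>R (v + w)"
    by (intro bexI[of _ "m + f + p + q"] bexI[of _ "m - f - p - q"])
      (auto simp: cube_points_def square_def frameD[OF f] simp flip: scaleR_2)
next
  fix x assume "\<exists>v\<in>cube_points m f p q. \<exists>w\<in>cube_points m f p q. pedoe v w = -5 \<and> x = (1/2) *\<^sub>R (v + w)"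
  then obtain v w where vw: "v \<in> cube_points m f p q" "w \<in> cube_points m f p q" "pedoe v w = -5"
    "x = (1/2) *\<^sub>R (v + w)" by blast
  then obtain a b c where s: "a \<in> {1,-1}" "b \<in> {1,-1}" "c \<in> {1,-1}"
    and v: "v = m + a *\<^sub>R f + b *\<^sub>R p + c *\<^sub>R q" unfolding mem_cube_points by blast
  obtain a' b' c' where s': "a' \<in> {1,-1}" "b' \<in> {1,-1}" "c' \<in> {1,-1}"
    and w: "w = m + a' *\<^sub>R f + b' *\<^sub>R p + c' *\<^sub>R q" using vw(2) unfolding mem_cube_points by blast
  have sum: "a * a' + b * b' + c * c' = -3" using vw(3) unfolding v w pedoe_cube_points[OF f] by simp
  have one: "t * t' = 1 \<and> t' = t \<or> t * t' = -1 \<and> t' = - t" if "t \<in> {1,-1}" "t' \<in> {1,-1}" for t t' :: real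
    using that by auto
  have "a' = - a \<and> b' = - b \<and> c' = - c"
    using sum one[OF s(1) s'(1)] one[OF s(2) s'(2)] one[OF s(3) s'(3)] by argo
  then show "x = m" unfolding vw(4) v w by (simp flip: scaleR_2)
qed

lemma face_cube_points:
  assumes f: "frame m f p q"
  shows "face (cube_points m f p q) f = square (m + f) p q"
  unfolding face_def cube_points_def square_def by (auto simp: frameD[OF f])

lemma cube_points_face:
  "cube_points m f p q = square (m + f) p q \<union> (\<lambda>x. x - 2 *\<^sub>R f) ` square (m + f) p q"
  unfolding cube_points_def square_def by (simp add: scaleR_2 algebra_simps)

definition framed_cube :: "(real^4) set \<Rightarrow> bool" where
  "framed_cube P \<longleftrightarrow> (\<exists>m f p q. frame m f p q \<and> P = cube_points m f p q)"

text \<open>Rotating the frame and changing a sign makes any direction the first frame vector, so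
  that facts about faces need proof for one face only.\<close>

lemma framed_cube_cases:
  assumes P: "framed_cube P" and g: "g \<in> directions P"
  obtains p q where "frame (center P) g p q" "P = cube_points (center P) g p q"
proof -
  obtain m f p q where f: "frame m f p q" and P: "P = cube_points m f p q"
    using P unfolding framed_cube_def by blast
  have m: "center P = m" using center_cube_points[OF f] P by simp
  have g: "g \<in> {f, - f, p, - p, q, - q}" using g unfolding P directions_cube_points[OF f] .
  have *: "\<exists>p q. frame m g p q \<and> P = cube_points m g p q"
    if "frame m f p q" "P = cube_points m f p q" "g = f \<or> g = - f" for f p q
    using that frame_uminus[of m f p q] cube_points_uminus[of m f p q] by auto
  have f2: "frame m p q f" and f3: "frame m q f p" using frame_rotate f by blast+
  have P2: "P = cube_points m p q f" using P cube_points_rotate[of m f p q] by simp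
  then have P3: "P = cube_points m q f p" using cube_points_rotate[of m p q f] by simp
  from g *[OF f P] *[OF f2 P2] *[OF f3 P3] show thesis using that unfolding m by blast
qed

lemma framed_cube_norm:
  assumes "framed_cube P" "v \<in> P"
  shows "pedoe v v = 1"
proof -
  obtain m f p q where f: "frame m f p q" and "P = cube_points m f p q"
    using assms unfolding framed_cube_def by blast
  with assms(2) show ?thesis by (auto simp: mem_cube_points frameD)
qed

text \<open>The reflection of the cube \<open>P\<close> in the hyperplane spanned by its face in direction \<open>g\<close>;
  the normal of the hyperplane is \<open>center P + 2 g\<close>.\<close>

definition neighbour :: "(real^4) set \<Rightarrow> real^4 \<Rightarrow> (real^4) set" where
  "neighbour P g = face P g \<union> (\<lambda>x. x + 4 *\<^sub>R center P + 6 *\<^sub>R g) ` face P g"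

text \<open>With n = \<open>center P + 2 g\<close> of norm 2, the reflection v - <v, n> n sends
  \<open>g\<close> to this vector and the centre to \<open>3 center P + 4 g\<close>. Seen from the
  neighbour it points at the common face; the far face lies at -2 times it, which is the shift in
  \<open>neighbour\<close>.\<close>

definition back_direction :: "(real^4) set \<Rightarrow> real^4 \<Rightarrow> real^4" where
  "back_direction P g = - 2 *\<^sub>R center P - 3 *\<^sub>R g"

lemma neighbour_frame:
  assumes f: "frame (center P) g p q" and P: "P = cube_points (center P) g p q"
  shows "frame (3 *\<^sub>R center P + 4 *\<^sub>R g) (back_direction P g) p q"
    and "neighbour P g = cube_points (3 *\<^sub>R center P + 4 *\<^sub>R g) (back_direction P g) p q"
proof -
  let ?m = "center P" and ?m' = "3 *\<^sub>R center P + 4 *\<^sub>R g" and ?g' = "back_direction P g"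
  show "frame ?m' ?g' p q" unfolding frame_def back_direction_def by (simp add: frameD[OF f])
  have F: "face P g = square (?m + g) p q" using face_cube_points[OF f] P by simp
  have c: "?m' + ?g' = ?m + g"
    unfolding back_direction_def by (simp add: vec_eq_iff)
  have s: "x + 4 *\<^sub>R ?m + 6 *\<^sub>R g = x - 2 *\<^sub>R ?g'" for x
    unfolding back_direction_def by (simp add: vec_eq_iff)
  show "neighbour P g = cube_points ?m' ?g' p q"
    unfolding neighbour_def cube_points_face c s F ..
qed

lemma
  assumes P: "framed_cube P" and g: "g \<in> directions P"
  shows framed_cube_neighbour: "framed_cube (neighbour P g)"
    and center_neighbour: "center (neighbour P g) = 3 *\<^sub>R center P + 4 *\<^sub>R g"
    and face_neighbour: "face (neighbour P g) (back_direction P g) = face P g"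
    and back_direction_mem: "back_direction P g \<in> directions (neighbour P g)"
    and neighbour_back: "neighbour (neighbour P g) (back_direction P g) = P"
    and neighbour_neq: "neighbour P g \<noteq> P"
proof -
  obtain p q where f: "frame (center P) g p q" and Pe: "P = cube_points (center P) g p q"
    using framed_cube_cases[OF P g] .
  note n = neighbour_frame[OF f Pe]
  show "framed_cube (neighbour P g)" unfolding framed_cube_def using n by blast
  show c: "center (neighbour P g) = 3 *\<^sub>R center P + 4 *\<^sub>R g"
    using center_cube_points[OF n(1)] n(2) by simp
  have "3 *\<^sub>R center P + 4 *\<^sub>R g + back_direction P g = center P + g"
    unfolding back_direction_def by (simp add: vec_eq_iff)
  then show F: "face (neighbour P g) (back_direction P g) = face P g"
    using face_cube_points[OF n(1)] face_cube_points[OF f] n(2) Pe by metis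
  show "back_direction P g \<in> directions (neighbour P g)"
    unfolding n(2) directions_cube_points[OF n(1)] by simp
  have "x + 4 *\<^sub>R center (neighbour P g) + 6 *\<^sub>R back_direction P g = x - 2 *\<^sub>R g" for x
    unfolding c unfolding back_direction_def by (simp add: vec_eq_iff)
  then have "neighbour (neighbour P g) (back_direction P g) =
      face P g \<union> (\<lambda>x. x - 2 *\<^sub>R g) ` face P g"
    unfolding neighbour_def[of "neighbour P g"] F by (simp only:)
  also have "face P g = square (center P + g) p q" using face_cube_points[OF f] Pe by metis
  also have "square (center P + g) p q \<union> (\<lambda>x. x - 2 *\<^sub>R g) ` square (center P + g) p q = P"
    using cube_points_face Pe by metis
  finally show "neighbour (neighbour P g) (back_direction P g) = P" .
  have "pedoe (3 *\<^sub>R center P + 4 *\<^sub>R g) g \<noteq> pedoe (center P) g" by (simp add: frameD[OF f])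
  then show "neighbour P g \<noteq> P" using c by metis
qed

lemma inj_on_neighbour: "framed_cube P \<Longrightarrow> inj_on (neighbour P) (directions P)"
  by (rule inj_onI) (metis add_left_cancel center_neighbour scaleR_left_imp_eq zero_neq_numeral)

text \<open>The vectors \<open>g'\<close> with \<open>\<langle>x, g'\<rangle> = 1\<close> on the face form a line parallel to the normal, which
  contains two vectors of norm 1: these belong to the two cubes with that face.\<close>

lemma common_face_neighbour:
  assumes P: "framed_cube P" "g \<in> directions P" and Q: "framed_cube Q" "g' \<in> directions Q"
    and F: "face P g = face Q g'" and neq: "P \<noteq> Q"
  shows "Q = neighbour P g"
proof -
  obtain p q where f: "frame (center P) g p q" and Pe: "P = cube_points (center P) g p q"
    using framed_cube_cases[OF P] .
  obtain p' q' where f': "frame (center Q) g' p' q'" and Qe: "Q = cube_points (center Q) g' p' q'"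
    using framed_cube_cases[OF Q] .
  define m where "m = center P"
  note d = frameD[OF f, folded m_def]
  have FP: "face P g = square (m + g) p q" unfolding m_def using face_cube_points[OF f] Pe by simp
  have FQ: "face Q g' = square (center Q + g') p' q'" using face_cube_points[OF f'] Qe by simp
  have PF: "P = face P g \<union> (\<lambda>x. x - 2 *\<^sub>R g) ` face P g"
    unfolding FP m_def using cube_points_face Pe by metis
  have QF: "Q = face P g \<union> (\<lambda>x. x - 2 *\<^sub>R g') ` face P g"
    unfolding F FQ using cube_points_face Qe by metis
  define n where "n = m + 2 *\<^sub>R g"
  define e where "e = g' - g"
  have e: "pedoe e x = 0" if "x \<in> face P g" for x
  proof -
    have "pedoe x g = 1" "pedoe x g' = 1" using that F by (auto simp: face_def)
    then show ?thesis by (simp add: e_def pedoe_commute)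
  qed
  \<comment> \<open>\<open>e\<close> and \<open>n\<close> are both orthogonal to the face, which
    spans a hyperplane, so they are proportional. The difference from the projection (where
    \<open>pedoe n n = 2\<close>) is shown orthogonal to the whole frame.\<close>
  have "e - (pedoe e n / 2) *\<^sub>R n = 0" (is "?z = 0")
  proof (rule orthogonal_frame_eq_0[OF f, folded m_def])
    have z: "pedoe ?z x = 0" if "x \<in> square (m + g) p q" for x
      using e[of x] that by (auto simp: FP square_def n_def d)
    have "pedoe n n = 2" by (simp add: n_def d)
    then have zn: "pedoe ?z n = 0" by simp
    have "pedoe ?z (m + g + p + q) = 0" "pedoe ?z (m + g + p - q) = 0"
      "pedoe ?z (m + g - p + q) = 0" by (rule z; simp add: square_def)+
    then have "pedoe ?z m + pedoe ?z g = 0" and *: "pedoe ?z p = 0" "pedoe ?z q = 0"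
      unfolding pedoe_add_right pedoe_diff_right by linarith+
    moreover have "pedoe ?z m + 2 * pedoe ?z g = 0"
      using zn unfolding n_def pedoe_add_right pedoe_scale_right .
    ultimately show "pedoe ?z m = 0" "pedoe ?z g = 0" by linarith+
    show "pedoe ?z p = 0" "pedoe ?z q = 0" using * by blast+
  qed
  then have "e = (pedoe e n / 2) *\<^sub>R n" by (simp only: right_minus_eq)
  moreover have "g' = g + e" by (simp add: e_def)
  ultimately obtain t where t: "g' = g + t *\<^sub>R n" by metis
  have "1 = pedoe g' g'" by (simp add: frameD[OF f'])
  also have "\<dots> = 1 + 4 * t + 2 * t * t" unfolding t n_def by (simp add: d algebra_simps)
  finally have "t * (t + 2) = 0" by (simp add: algebra_simps)
  \<comment> \<open>The root 0 gives \<open>Q = P\<close>; the root -2 makes \<open>g'\<close> equal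
    to \<open>back_direction P g\<close>.\<close>
  then consider "t = 0" | "t = -2" by (auto simp: add_eq_0_iff2)
  then show ?thesis
  proof cases
    case 1
    then have "g' = g" using t by simp
    with PF QF neq show ?thesis by simp
  next
    case 2
    then have "x - 2 *\<^sub>R g' = x + 4 *\<^sub>R center P + 6 *\<^sub>R g" for x
      unfolding t n_def m_def by (simp add: vec_eq_iff)
    with QF show ?thesis unfolding neighbour_def by simp
  qed
qed

section \<open>Labelled cubes, the Gram matrix and the sides\<close>

definition frame_list :: "real^4 \<Rightarrow> real^4 \<Rightarrow> real^4 \<Rightarrow> real^4 \<Rightarrow> (real^4) list" where
  "frame_list m f p q =
    [m - f - p - q, m + f - p - q, m + f + p - q, m - f + p - q,
     m + f + p + q, m - f + p + q, m - f - p + q, m + f - p + q]"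

lemma set_frame_list: "set (frame_list m f p q) = cube_points m f p q"
  by (auto simp: frame_list_def cube_points_def square_def)

lemma all_less_8:
  "(\<forall>i<8. Q (i::nat)) \<longleftrightarrow> Q 0 \<and> Q 1 \<and> Q 2 \<and> Q 3 \<and> Q 4 \<and> Q 5 \<and> Q 6 \<and> Q 7"
  by (auto simp: numeral_eq_Suc All_less_Suc)

lemma frame_list_gram:
  assumes "frame m f p q"
  shows "\<forall>i<8. \<forall>j<8. pedoe (frame_list m f p q ! i) (frame_list m f p q ! j) = cube_gram ! i ! j"
  unfolding all_less_8 frame_list_def cube_gram_def by (simp add: frameD[OF assms])

text \<open>The circles with product -1 to C_1 are C_2, C_4 and C_7; half of these three edges gives
  \<open>f\<close>, \<open>p\<close>, \<open>q\<close>. The remaining four circles are then pinned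
  down by their products with the frame, known from the Gram matrix.\<close>

lemma gram_frame_list:
  assumes len: "length vs = 8"
    and gram: "\<forall>i<8. \<forall>j<8. pedoe (vs ! i) (vs ! j) = cube_gram ! i ! j"
  shows "\<exists>m f p q. frame m f p q \<and> vs = frame_list m f p q"
proof -
  obtain v1 v2 v3 v4 v5 v6 v7 v8 where vs: "vs = [v1, v2, v3, v4, v5, v6, v7, v8]"
    using len by (auto simp: length_Suc_conv numeral_eq_Suc)
  note g = gram[unfolded all_less_8 vs cube_gram_def, simplified]
  define f where "f = (1/2) *\<^sub>R (v2 - v1)"
  define p where "p = (1/2) *\<^sub>R (v4 - v1)"
  define q where "q = (1/2) *\<^sub>R (v7 - v1)"
  define m where "m = v1 + f + p + q"
  have fr: "frame m f p q"
    unfolding frame_def m_def f_def p_def q_def by (simp add: g)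
  have eq: "v = w" if "pedoe v m = pedoe w m" "pedoe v f = pedoe w f" "pedoe v p = pedoe w p"
    "pedoe v q = pedoe w q" for v w
    using orthogonal_frame_eq_0[OF fr, of "v - w"] that by simp
  note d = frameD[OF fr]
  have "v1 = m - f - p - q" "v2 = m + f - p - q" "v4 = m - f + p - q" "v7 = m - f - p + q"
    unfolding m_def f_def p_def q_def by (simp_all add: vec_eq_iff field_simps)
  moreover have "v3 = m + f + p - q"
    by (rule eq; simp only: pedoe_diff_left pedoe_add_left d; simp add: m_def f_def p_def q_def g)
  moreover have "v5 = m + f + p + q"
    by (rule eq; simp only: pedoe_diff_left pedoe_add_left d; simp add: m_def f_def p_def q_def g)
  moreover have "v6 = m - f + p + q"
    by (rule eq; simp only: pedoe_diff_left pedoe_add_left d; simp add: m_def f_def p_def q_def g)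
  moreover have "v8 = m + f - p + q"
    by (rule eq; simp only: pedoe_diff_left pedoe_add_left d; simp add: m_def f_def p_def q_def g)
  ultimately show ?thesis using fr unfolding vs frame_list_def by blast
qed

lemma sides_frame_list:
  assumes f: "frame m f p q"
  shows "{(\<lambda>i. frame_list m f p q ! (i - 1)) ` I | I. I \<in> side_indices} =
    face (cube_points m f p q) ` directions (cube_points m f p q)"
proof -
  have "(\<lambda>i. frame_list m f p q ! (i - 1)) ` {1, 2, 3, 4} = face (cube_points m f p q) (- q)"
    "(\<lambda>i. frame_list m f p q ! (i - 1)) ` {5, 6, 7, 8} = face (cube_points m f p q) q"
    "(\<lambda>i. frame_list m f p q ! (i - 1)) ` {1, 2, 8, 7} = face (cube_points m f p q) (- p)"
    "(\<lambda>i. frame_list m f p q ! (i - 1)) ` {2, 3, 5, 8} = face (cube_points m f p q) f"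
    "(\<lambda>i. frame_list m f p q ! (i - 1)) ` {3, 4, 6, 5} = face (cube_points m f p q) p"
    "(\<lambda>i. frame_list m f p q ! (i - 1)) ` {1, 4, 6, 7} = face (cube_points m f p q) (- f)"
    unfolding face_def cube_points_def square_def frame_list_def by (auto simp: frameD[OF f])
  then show ?thesis
    unfolding directions_cube_points[OF f] setcompr_eq_image Collect_mem_eq side_indices_def
      image_insert[where f = "\<lambda>I. (\<lambda>i. frame_list m f p q ! (i - 1)) ` I"] image_insert[where f = "face _"]
    by (simp only: image_empty) (simp only: insert_commute)
qed

section \<open>Paths without backtracking\<close>

text \<open>\<open>wall u P g\<close> measures on which side of the wall of \<open>P\<close> in direction \<open>g\<close> the timelike
  vector \<open>u\<close> lies. Walking away from \<open>u\<close>, only the wall just crossed is negative, and it is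
  outweighed by all the others.\<close>

definition wall :: "real^4 \<Rightarrow> (real^4) set \<Rightarrow> real^4 \<Rightarrow> real" where
  "wall u P g = - pedoe u (center P + 2 *\<^sub>R g)"

definition walking_away :: "real^4 \<Rightarrow> (real^4) set \<Rightarrow> real^4 \<Rightarrow> bool" where
  "walking_away u P b \<longleftrightarrow> wall u P b < 0 \<and>
     (\<forall>g\<in>directions P. g \<noteq> b \<longrightarrow> wall u P g > - wall u P b)"

text \<open>The walls of the neighbour are the mirror images of those of \<open>P\<close> in the
  wall crossed. The image of a normal n' is n' - <n', n> n with <n', n> = -2 for adjacent and -6 for
  opposite faces, hence the factors 2 and 6.\<close>

lemma wall_neighbour:
  assumes P: "framed_cube P" and g: "g \<in> directions P"
  shows "wall u (neighbour P g) (back_direction P g) = - wall u P g"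
    and "- pedoe u (center (neighbour P g)) = - pedoe u (center P) + 2 * wall u P g"
    and "h \<in> directions (neighbour P g) \<Longrightarrow> h \<noteq> back_direction P g \<Longrightarrow>
      (\<exists>h'\<in>directions P. h' \<noteq> g \<and> (wall u (neighbour P g) h = wall u P h' + 2 * wall u P g
        \<or> wall u (neighbour P g) h = wall u P h' + 6 * wall u P g))"
proof -
  note c = center_neighbour[OF P g]
  show "wall u (neighbour P g) (back_direction P g) = - wall u P g"
    unfolding wall_def c back_direction_def by simp
  show "- pedoe u (center (neighbour P g)) = - pedoe u (center P) + 2 * wall u P g"
    unfolding wall_def c by simp
  obtain p q where f: "frame (center P) g p q" and Pe: "P = cube_points (center P) g p q"
    using framed_cube_cases[OF P g] .
  note n = neighbour_frame[OF f Pe]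
  have D: "directions P = {g, - g, p, - p, q, - q}" using directions_cube_points[OF f] Pe by simp
  have D': "directions (neighbour P g) = {back_direction P g, - back_direction P g, p, - p, q, - q}"
    unfolding n(2) by (rule directions_cube_points[OF n(1)])
  have ne: "- g \<noteq> g" "p \<noteq> g" "- p \<noteq> g" "q \<noteq> g" "- q \<noteq> g" using frameD[OF f]
    by (metis pedoe_minus_left one_neq_zero zero_neq_one neg_equal_0_iff_equal one_neq_neg_one)+
  assume h: "h \<in> directions (neighbour P g)" "h \<noteq> back_direction P g"
  show "\<exists>h'\<in>directions P. h' \<noteq> g \<and> (wall u (neighbour P g) h = wall u P h' + 2 * wall u P g
        \<or> wall u (neighbour P g) h = wall u P h' + 6 * wall u P g)"
  proof (cases "h = - back_direction P g")
    case True
    then have "wall u (neighbour P g) h = wall u P (- g) + 6 * wall u P g"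
      unfolding wall_def c by (simp add: back_direction_def)
    then show ?thesis using ne D by auto
  next
    case False
    then have "h \<in> {p, - p, q, - q}" using h D' by blast
    moreover have "wall u (neighbour P g) h = wall u P h + 2 * wall u P g"
      unfolding wall_def c by simp
    ultimately show ?thesis using ne D by auto
  qed
qed

lemma walking_away_step:
  assumes P: "framed_cube P" and g: "g \<in> directions P" "wall u P g > 0"
    and other: "\<And>h. h \<in> directions P \<Longrightarrow> h \<noteq> g \<Longrightarrow> wall u P h > - wall u P g"
  shows "walking_away u (neighbour P g) (back_direction P g)"
  unfolding walking_away_def
proof (intro conjI ballI impI)
  note w = wall_neighbour[OF P g(1)]
  show "wall u (neighbour P g) (back_direction P g) < 0" using w(1) g by simp
  fix h assume h: "h \<in> directions (neighbour P g)" "h \<noteq> back_direction P g"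
  obtain h' where "h' \<in> directions P" "h' \<noteq> g" and
    e: "wall u (neighbour P g) h = wall u P h' + 2 * wall u P g
        \<or> wall u (neighbour P g) h = wall u P h' + 6 * wall u P g"
    using w(3)[OF h] by blast
  then have "wall u P h' > - wall u P g" using other by blast
  with e g(2) show "wall u (neighbour P g) h > - wall u (neighbour P g) (back_direction P g)"
    unfolding w(1) by auto
qed

text \<open>The height \<open>- pedoe u (center (P t))\<close> over the initial centre
  \<open>u\<close> grows at every step, because a path that does not turn back never crosses the one
  wall with negative value.\<close>

lemma path_no_return:
  fixes P :: "nat \<Rightarrow> (real^4) set"
  assumes P: "\<And>t. framed_cube (P t)"
    and step: "\<And>t. \<exists>g\<in>directions (P t). P (Suc t) = neighbour (P t) g"
    and no_back: "\<And>t. P (Suc (Suc t)) \<noteq> P t"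
  shows "P (Suc t) \<noteq> P 0"
proof -
  obtain g where g: "\<And>t. g t \<in> directions (P t)" and nb: "\<And>t. P (Suc t) = neighbour (P t) (g t)"
    using step by metis
  define b where "b t = back_direction (P t) (g t)" for t
  define u where "u = center (P 0)"
  have gb: "g (Suc t) \<noteq> b t" for t
    using neighbour_back[OF P g] nb no_back[of t] unfolding b_def by metis
  \<comment> \<open>The centre \<open>u\<close> has norm -2 and is orthogonal to \<open>h\<close>,
    so it lies on the same side of all six walls.\<close>
  have wall0: "wall u (P 0) h = 2" if h: "h \<in> directions (P 0)" for h
  proof -
    obtain p q where "frame u h p q" using framed_cube_cases[OF P[of 0] h] unfolding u_def by blast
    from frameD[OF this] show ?thesis by (simp add: wall_def u_def)
  qed
  have "- pedoe u (center (P (Suc t))) > - pedoe u (center (P 0)) \<and> walking_away u (P (Suc t)) (b t)"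
  proof (induction t)
    case 0
    show ?case
      unfolding nb b_def wall_neighbour(2)[OF P g]
      using wall0 g by (auto intro!: walking_away_step P)
  next
    case (Suc t)
    note Pn = nb[of "Suc t"]
    from Suc have w: "walking_away u (P (Suc t)) (b t)" by blast
    have 1: "wall u (P (Suc t)) (g (Suc t)) > - wall u (P (Suc t)) (b t)"
      and 2: "wall u (P (Suc t)) (b t) < 0"
      using w g gb unfolding walking_away_def by blast+
    have "wall u (P (Suc t)) h > - wall u (P (Suc t)) (g (Suc t))"
      if "h \<in> directions (P (Suc t))" for h
      using w that 1 2 unfolding walking_away_def by (cases "h = b t") (simp, force)
    with 1 2 have "walking_away u (P (Suc (Suc t))) (b (Suc t))"
      unfolding Pn b_def by (intro walking_away_step P g) auto
    then show ?case using Suc 1 2 wall_neighbour(2)[OF P g, of u "Suc t"] Pn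
      by simp
  qed
  then show ?thesis by (metis less_irrefl)
qed

section \<open>Bianchi circles as lattice vectors\<close>

lemma oriented_circle_coords:
  assumes "oriented_circle C"
  obtains b' b a where "circle_coords C b' b a" "circle_vec C = vector [b', b, Re a, Im a]"
  using circle_coords_unique[OF assms] circle_vec_eq[OF assms] by metis

lemma pedoe_coords:
  "pedoe (vector [b', b, Re a, Im a]) (vector [b', b, Re a, Im a]) = 1 \<longleftrightarrow> b * b' = (cmod a)\<^sup>2 - 1"
  unfolding pedoe_def cmod_power2 by (auto simp: power2_eq_square)

lemma circle_norm_solve:
  assumes n: "b * b' = (cmod a)\<^sup>2 - 1" and b: "b \<noteq> 0"
  shows "b' = b * ((cmod (a / of_real b))\<^sup>2 - (1 / b)\<^sup>2)"
proof -
  have "b * ((cmod (a / of_real b))\<^sup>2 - (1 / b)\<^sup>2) = ((cmod a)\<^sup>2 - 1) / b"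
    using b by (simp add: norm_divide power_divide diff_divide_distrib right_diff_distrib power2_eq_square)
  also have "\<dots> = b'" unfolding n[symmetric] using b by simp
  finally show ?thesis ..
qed

text \<open>The circle has centre a / b and radius 1 / |b|. For \<open>b = 0\<close> it is the line
  through (b' / 2) a, the foot of the perpendicular from 0, in direction \<open>- \<i> * a\<close>,
  which has \<open>a\<close> as its left normal.\<close>

lemma circle_coords_exist:
  assumes n: "b * b' = (cmod a)\<^sup>2 - 1"
  shows "\<exists>C. oriented_circle C \<and> circle_coords C b' b a"
proof -
  consider "b > 0" | "b < 0" | "b = 0" by linarith
  then show ?thesis
  proof cases
    case 1
    then have "b' = ((cmod (a / of_real b))\<^sup>2 - (1 / b)\<^sup>2) / (1 / b)"
      using circle_norm_solve[OF n] by simp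
    then have "circle_coords (ccw_circle (a / of_real b) (1 / b)) b' b a"
      using 1 by (subst coords_ccw) simp_all
    then show ?thesis unfolding oriented_circle_def using 1 by (metis zero_less_divide_1_iff)
  next
    case 2
    then have "b' = - ((cmod (a / of_real b))\<^sup>2 - (- 1 / b)\<^sup>2) / (- 1 / b)"
      using circle_norm_solve[OF n] by (simp add: algebra_simps)
    moreover have r: "- 1 / b > 0" using 2 by (simp add: divide_pos_neg zero_less_divide_iff)
    ultimately have "circle_coords (cw_circle (a / of_real b) (- 1 / b)) b' b a"
      using 2 by (subst coords_cw[OF r]) simp
    then show ?thesis unfolding oriented_circle_def using r by blast
  next
    case 3
    then have a: "cmod a = 1" using n by (simp add: power2_eq_1_iff) (smt (verit) norm_ge_zero)
    then have d: "cmod (- \<i> * a) = 1" by (simp add: norm_mult)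
    have "2 * Re (cnj a * (of_real (b' / 2) * a)) = b' * (cmod a)\<^sup>2"
      unfolding cmod_power2 by (simp add: power2_eq_square algebra_simps)
    then have "circle_coords (oriented_line (of_real (b' / 2) * a) (- \<i> * a)) b' b a"
      using 3 a by (subst coords_line[OF d]) (simp flip: mult.assoc)
    then show ?thesis unfolding oriented_circle_def using d by blast
  qed
qed

lemma circle_coords_inj:
  assumes C: "oriented_circle C" "circle_coords C b' b a" and D: "oriented_circle D" "circle_coords D b' b a"
  shows "C = D"
proof -
  consider "b > 0" | "b < 0" | "b = 0" by linarith
  then show ?thesis
  proof cases
    case 1
    then obtain c r c' r' where "r > 0" "C = ccw_circle c r" "r' > 0" "D = ccw_circle c' r'"
      using C D unfolding circle_coords_def by blast
    then show ?thesis using C(2) D(2) coords_ccw[of r c b' b a] coords_ccw[of r' c' b' b a] by auto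
  next
    case 2
    then obtain c r c' r' where "r > 0" "C = cw_circle c r" "r' > 0" "D = cw_circle c' r'"
      using C D unfolding circle_coords_def by blast
    then show ?thesis using C(2) D(2) coords_cw[of r c b' b a] coords_cw[of r' c' b' b a] by auto
  next
    case 3
    have line: "\<exists>p d. cmod d = 1 \<and> E = oriented_line p d"
      if "oriented_circle E" "circle_coords E b' b a" for E
      using that 3 unfolding oriented_circle_def circle_coords_def by auto
    obtain p d where p: "cmod d = 1" "C = oriented_line p d" using line[OF C] by blast
    obtain q e where q: "cmod e = 1" "D = oriented_line q e" using line[OF D] by blast
    have pc: "a = \<i> * d \<and> b' = 2 * Re (cnj a * p)" using coords_line[OF p(1)] C(2) p(2) by blast
    have qc: "a = \<i> * e \<and> b' = 2 * Re (cnj a * q)" using coords_line[OF q(1)] D(2) q(2) by blast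
    have e: "e = d" using pc qc by simp
    \<comment> \<open>The base points \<open>p\<close> and \<open>q\<close> may differ by a shift
      along \<open>d\<close>, so the half-planes are compared instead.\<close>
    have "Im ((z - p) * cnj d) = Im ((z - q) * cnj d)" for z
      using pc qc by (auto simp: algebra_simps)
    then have "snd C = snd D" unfolding p q e oriented_line_def by simp
    moreover have "fst C = fst D" using C(2) D(2) unfolding circle_coords_def by simp
    ultimately show ?thesis by (simp add: prod_eq_iff)
  qed
qed

lemma circle_points_uminus: "circle_points (- b') (- b) (- a) = circle_points b' b a"
proof -
  have "of_real (- b) * X * cnj X - - a * Y * cnj X - cnj (- a) * X * cnj Y + of_real (- b') * Y * cnj Y =
    - (of_real b * X * cnj X - a * Y * cnj X - cnj a * X * cnj Y + of_real b' * Y * cnj Y)" for X Y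
    by simp
  then show ?thesis unfolding circle_points_def by (simp only: neg_equal_0_iff_equal)
qed

text \<open>A point set fixes the coordinates up to the sign that reverses the orientation.\<close>

lemma circle_points_eq:
  assumes eq: "circle_points b' b a = circle_points c' c e"
    and n: "b * b' = (cmod a)\<^sup>2 - 1" "c * c' = (cmod e)\<^sup>2 - 1"
  shows "c' = b' \<and> c = b \<and> e = a \<or> c' = - b' \<and> c = - b \<and> e = - a"
proof (cases "b = 0")
  case False
  define r where "r = 1 / \<bar>b\<bar>"
  have r: "r > 0" "b\<^sup>2 * r\<^sup>2 = 1" using False by (simp_all add: r_def power_divide)
  have b': "b' = b * ((cmod (a / of_real b))\<^sup>2 - r\<^sup>2)"
    using circle_norm_solve[OF n(1) False] by (simp add: r_def power_divide)
  have "circle_points b' b a = Some ` sphere (a / of_real b) r"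
    using circle_points_sphere[OF r(1) False, of "a / of_real b"] False by (simp flip: b')
  then have "circle_points c' c e = Some ` sphere (a / of_real b) r" using eq by simp
  note u = sphere_unique[OF r(1) this n(2)]
  have "c\<^sup>2 = b\<^sup>2" using u(3) r(2) by (metis mult_right_cancel mult_zero_right zero_neq_one)
  then have "c = b \<or> c = - b" by (simp add: power2_eq_iff)
  then show ?thesis
  proof
    assume "c = b"
    then show ?thesis using u(1,2) b' False by simp
  next
    assume "c = - b"
    then show ?thesis using u(1,2) b' False by simp
  qed
next
  case True
  then have c: "c = 0" using eq None_circle_points by blast
  have a: "(Re a)\<^sup>2 + (Im a)\<^sup>2 = 1" and e: "(Re e)\<^sup>2 + (Im e)\<^sup>2 = 1"
    using n True c by (simp_all add: cmod_power2)
  have on: "circle_form c' c e z = 0" if "circle_form b' b a z = 0" for z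
    using that eq Some_circle_points by blast
  \<comment> \<open>x + i y is \<open>a * cnj e\<close>, to be shown equal to 1 or -1; two points of
    the line suffice for that.\<close>
  define x where "x = Re a * Re e + Im a * Im e"
  define y where "y = Re e * Im a - Im e * Re a"
  have "b' * ((Re a)\<^sup>2 + (Im a)\<^sup>2) = b'" by (simp add: a)
  then have "circle_form b' b a (of_real (b' / 2) * a) = 0"
    "circle_form b' b a (of_real (b' / 2) * a + \<i> * a) = 0"
    by (auto simp: circle_form_def True power2_eq_square algebra_simps)
  from on[OF this(1)] on[OF this(2)] have "c' = b' * x" "y = 0"
    by (auto simp: circle_form_def c x_def y_def algebra_simps)
  moreover have "x\<^sup>2 + y\<^sup>2 = ((Re a)\<^sup>2 + (Im a)\<^sup>2) * ((Re e)\<^sup>2 + (Im e)\<^sup>2)"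
    unfolding x_def y_def by (simp add: power2_eq_square algebra_simps)
  ultimately have x: "x = 1 \<or> x = -1" by (simp add: a e power2_eq_1_iff)
  have "Re e * ((Re a)\<^sup>2 + (Im a)\<^sup>2) = Re a * x + Im a * y"
    "Im e * ((Re a)\<^sup>2 + (Im a)\<^sup>2) = Im a * x - Re a * y"
    unfolding x_def y_def by (simp_all add: power2_eq_square algebra_simps)
  then have "e = of_real x * a" using \<open>y = 0\<close> a by (intro complex_eqI) (simp_all add: mult.commute)
  with x \<open>c' = b' * x\<close> True c show ?thesis by auto
qed

section \<open>Coordinates of the images of the extended reals\<close>

lemma Z_sqrt_m2_iff: "z \<in> Z_sqrt_m2 \<longleftrightarrow> (\<exists>x y :: int. Re z = of_int x \<and> Im z = sqrt 2 * of_int y)"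
proof -
  have s: "csqrt (-2) = \<i> * of_real (sqrt 2)"
    by (rule csqrt_unique) (auto simp: power_mult_distrib simp flip: of_real_power)
  have "z = of_int x + of_int y * csqrt (-2) \<longleftrightarrow> Re z = of_int x \<and> Im z = sqrt 2 * of_int y" for x y :: int
    unfolding s complex_eq_iff by (simp add: mult.commute)
  then show ?thesis unfolding Z_sqrt_m2_def by auto
qed

lemma quot_pt_scale: "c \<noteq> 0 \<Longrightarrow> quot_pt (c * X) (c * Y) = quot_pt X Y"
  by (simp add: quot_pt_def)

text \<open>With \<open>U = \<delta> X - \<beta> Y\<close> and \<open>V = \<alpha> Y - \<gamma> X\<close>, the point \<open>X / Y\<close> is the image of \<open>U / V\<close>, which is
  real iff \<open>U\<close> times the conjugate of \<open>V\<close> is.\<close>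

lemma moebius_extended_reals:
  fixes M :: "complex^2^2"
  defines "\<alpha> \<equiv> M$1$1" and "\<beta> \<equiv> M$1$2" and "\<gamma> \<equiv> M$2$1" and "\<delta> \<equiv> M$2$2"
  assumes det: "\<alpha> * \<delta> - \<beta> * \<gamma> = 1"
  shows "moebius M ` extended_reals =
    circle_points (2 * Im (\<beta> * cnj \<alpha>)) (2 * Im (\<delta> * cnj \<gamma>)) (\<i> * (\<alpha> * cnj \<delta> - \<beta> * cnj \<gamma>))"
    (is "_ = circle_points ?b' ?b ?a")
proof -
  have form: "of_real ?b * X * cnj X - ?a * Y * cnj X - cnj ?a * X * cnj Y + of_real ?b' * Y * cnj Y =
      of_real (- 2 * Im ((\<delta> * X - \<beta> * Y) * cnj (\<alpha> * Y - \<gamma> * X)))" for X Y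
    by (rule complex_eqI) (auto simp: algebra_simps)
  have inv: "\<delta> * (\<alpha> * U + \<beta> * V) - \<beta> * (\<gamma> * U + \<delta> * V) = U"
    "\<alpha> * (\<gamma> * U + \<delta> * V) - \<gamma> * (\<alpha> * U + \<beta> * V) = V" for U V
    using arg_cong[OF det, of "\<lambda>x. x * U"] arg_cong[OF det, of "\<lambda>x. x * V"]
    by (simp_all add: algebra_simps)
  have inv': "\<alpha> * (\<delta> * X - \<beta> * Y) + \<beta> * (\<alpha> * Y - \<gamma> * X) = X"
    "\<gamma> * (\<delta> * X - \<beta> * Y) + \<delta> * (\<alpha> * Y - \<gamma> * X) = Y" for X Y
    using arg_cong[OF det, of "\<lambda>x. x * X"] arg_cong[OF det, of "\<lambda>x. x * Y"]
    by (simp_all add: algebra_simps)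
  have mem: "quot_pt (\<alpha> * U + \<beta> * V) (\<gamma> * U + \<delta> * V) \<in> circle_points ?b' ?b ?a"
    if "(U, V) \<noteq> (0, 0)" "Im (U * cnj V) = 0" for U V
    unfolding circle_points_def form
  proof (intro CollectI exI conjI)
    show "(\<alpha> * U + \<beta> * V, \<gamma> * U + \<delta> * V) \<noteq> (0, 0)" using that(1) inv[of U V] by auto
    show "of_real (- 2 * Im ((\<delta> * (\<alpha> * U + \<beta> * V) - \<beta> * (\<gamma> * U + \<delta> * V)) *
        cnj (\<alpha> * (\<gamma> * U + \<delta> * V) - \<gamma> * (\<alpha> * U + \<beta> * V)))) = (0 :: complex)"
      unfolding inv that(2) by simp
  qed (rule HOL.refl)
  show ?thesis
  proof
    show "moebius M ` extended_reals \<subseteq> circle_points ?b' ?b ?a"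
    proof
      fix x assume "x \<in> moebius M ` extended_reals"
      then consider t where "x = moebius M (Some (of_real t))" | "x = moebius M None"
        by (auto simp: extended_reals_def Reals_def)
      then show "x \<in> circle_points ?b' ?b ?a"
      proof cases
        case (1 t)
        then show ?thesis using mem[of "of_real t" 1] by (simp add: \<alpha>_def \<beta>_def \<gamma>_def \<delta>_def)
      next
        case 2
        then show ?thesis using mem[of 1 0] by (simp add: \<alpha>_def \<gamma>_def)
      qed
    qed
    show "circle_points ?b' ?b ?a \<subseteq> moebius M ` extended_reals"
    proof
      fix x assume "x \<in> circle_points ?b' ?b ?a"
      then obtain X Y where x: "x = quot_pt X Y" "(X, Y) \<noteq> (0, 0)"
        and "of_real (- 2 * Im ((\<delta> * X - \<beta> * Y) * cnj (\<alpha> * Y - \<gamma> * X))) = (0 :: complex)"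
        unfolding circle_points_def form by blast
      then have i: "Im ((\<delta> * X - \<beta> * Y) * cnj (\<alpha> * Y - \<gamma> * X)) = 0"
        unfolding of_real_eq_0_iff by linarith
      define U where "U = \<delta> * X - \<beta> * Y"
      define V where "V = \<alpha> * Y - \<gamma> * X"
      have XY: "X = \<alpha> * U + \<beta> * V" "Y = \<gamma> * U + \<delta> * V" unfolding U_def V_def by (simp_all add: inv')
      show "x \<in> moebius M ` extended_reals"
      proof (cases "V = 0")
        case True
        then have "U \<noteq> 0" using x(2) XY by auto
        then have "x = moebius M None" using x(1) XY True quot_pt_scale[of U \<alpha> \<gamma>]
          by (simp add: \<alpha>_def \<gamma>_def mult.commute)
        then show ?thesis by (auto simp: extended_reals_def)
      next
        case False
        have "Im (U / V) = 0"
          using i unfolding U_def[symmetric] V_def[symmetric] by (simp add: Im_divide)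
        then have "Some (U / V) \<in> extended_reals"
          by (simp add: extended_reals_def complex_is_Real_iff)
        moreover have "X = V * (\<alpha> * (U / V) + \<beta>)" "Y = V * (\<gamma> * (U / V) + \<delta>)"
          using False XY by (simp_all add: algebra_simps)
        then have "x = moebius M (Some (U / V))" using x(1) quot_pt_scale[OF False]
          by (simp only: moebius.simps \<alpha>_def \<beta>_def \<gamma>_def \<delta>_def)
        ultimately show ?thesis by blast
      qed
    qed
  qed
qed

definition SL2_coords :: "real \<Rightarrow> real \<Rightarrow> complex \<Rightarrow> bool" where
  "SL2_coords b' b a \<longleftrightarrow> (\<exists>\<alpha>\<in>Z_sqrt_m2. \<exists>\<beta>\<in>Z_sqrt_m2. \<exists>\<gamma>\<in>Z_sqrt_m2. \<exists>\<delta>\<in>Z_sqrt_m2.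
     \<alpha> * \<delta> - \<beta> * \<gamma> = 1 \<and> b' = 2 * Im (\<beta> * cnj \<alpha>) \<and> b = 2 * Im (\<delta> * cnj \<gamma>) \<and>
     a = \<i> * (\<alpha> * cnj \<delta> - \<beta> * cnj \<gamma>))"

lemma bianchi_circle_iff_coords:
  "bianchi_circle S \<longleftrightarrow> (\<exists>b' b a. SL2_coords b' b a \<and> S = circle_points b' b a)"
proof
  assume "bianchi_circle S"
  then obtain M :: "complex^2^2" where M: "\<And>i j. M$i$j \<in> Z_sqrt_m2" "det M = 1"
    and S: "S = moebius M ` extended_reals" unfolding bianchi_circle_def by blast
  have "M$1$1 * M$2$2 - M$1$2 * M$2$1 = 1" using M(2) by (simp add: det_2)
  from moebius_extended_reals[OF this] S M(1) this
  show "\<exists>b' b a. SL2_coords b' b a \<and> S = circle_points b' b a" unfolding SL2_coords_def by blast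
next
  assume "\<exists>b' b a. SL2_coords b' b a \<and> S = circle_points b' b a"
  then obtain b' b a \<alpha> \<beta> \<gamma> \<delta> where
    m: "\<alpha> \<in> Z_sqrt_m2" "\<beta> \<in> Z_sqrt_m2" "\<gamma> \<in> Z_sqrt_m2" "\<delta> \<in> Z_sqrt_m2" "\<alpha> * \<delta> - \<beta> * \<gamma> = 1" and
    e: "b' = 2 * Im (\<beta> * cnj \<alpha>)" "b = 2 * Im (\<delta> * cnj \<gamma>)" "a = \<i> * (\<alpha> * cnj \<delta> - \<beta> * cnj \<gamma>)"
    and S: "S = circle_points b' b a" unfolding SL2_coords_def by blast
  define M :: "complex^2^2" where "M = vector [vector [\<alpha>, \<beta>], vector [\<gamma>, \<delta>]]"
  have M: "M$1$1 = \<alpha>" "M$1$2 = \<beta>" "M$2$1 = \<gamma>" "M$2$2 = \<delta>" by (simp_all add: M_def)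
  have "\<forall>i j. M$i$j \<in> Z_sqrt_m2" using m by (simp add: forall_2 M)
  moreover have "det M = 1" using m by (simp add: det_2 M)
  moreover have "S = moebius M ` extended_reals"
    using moebius_extended_reals[of M] m unfolding M S e by simp
  ultimately show "bianchi_circle S" unfolding bianchi_circle_def by blast
qed

lemma SL2_coords_lattice:
  assumes "SL2_coords b' b a"
  shows "\<exists>i j k l :: int. b' = 2 * sqrt 2 * of_int i \<and> b = 2 * sqrt 2 * of_int j \<and>
      Re a = 2 * sqrt 2 * of_int k \<and> Im a = 2 * of_int l + 1"
    and "b * b' = (cmod a)\<^sup>2 - 1"
proof -
  obtain \<alpha> \<beta> \<gamma> \<delta> where m: "\<alpha> \<in> Z_sqrt_m2" "\<beta> \<in> Z_sqrt_m2" "\<gamma> \<in> Z_sqrt_m2" "\<delta> \<in> Z_sqrt_m2"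
    and det: "\<alpha> * \<delta> - \<beta> * \<gamma> = 1" and
    e: "b' = 2 * Im (\<beta> * cnj \<alpha>)" "b = 2 * Im (\<delta> * cnj \<gamma>)" "a = \<i> * (\<alpha> * cnj \<delta> - \<beta> * cnj \<gamma>)"
    using assms unfolding SL2_coords_def by blast
  have "(cmod a)\<^sup>2 - b * b' = (cmod (\<alpha> * \<delta> - \<beta> * \<gamma>))\<^sup>2"
    unfolding e cmod_power2 by (simp add: power2_eq_square algebra_simps)
  then show "b * b' = (cmod a)\<^sup>2 - 1" by (simp add: det)
  obtain a1 a2 b1 b2 c1 c2 d1 d2 :: int where
    r: "Re \<alpha> = of_int a1" "Im \<alpha> = sqrt 2 * of_int a2" "Re \<beta> = of_int b1" "Im \<beta> = sqrt 2 * of_int b2"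
      "Re \<gamma> = of_int c1" "Im \<gamma> = sqrt 2 * of_int c2" "Re \<delta> = of_int d1" "Im \<delta> = sqrt 2 * of_int d2"
    using m unfolding Z_sqrt_m2_iff by blast
  have s: "sqrt 2 * (sqrt 2 * x) = 2 * x" for x by (simp flip: mult.assoc)
  \<comment> \<open>Each part of the determinant equation trades half of the terms of
    \<open>a\<close> for the other half. This doubles the remaining ones: hence the factor
    \<open>2 * sqrt 2\<close> in \<open>Re a\<close>, and \<open>Im a\<close> = 1 mod 4.\<close>
  have det': "Re (\<alpha> * \<delta> - \<beta> * \<gamma>) = 1" "Im (\<alpha> * \<delta> - \<beta> * \<gamma>) = 0" unfolding det by simp_all
  have "b' = 2 * sqrt 2 * of_int (b2 * a1 - b1 * a2)" "b = 2 * sqrt 2 * of_int (d2 * c1 - d1 * c2)"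
    unfolding e by (simp_all add: r algebra_simps)
  moreover have "Re a = 2 * sqrt 2 * of_int (a1 * d2 - b1 * c2)"
    using det'(2) unfolding e by (simp add: r algebra_simps)
  moreover have "Im a = 2 * of_int (2 * (a2 * d2 - b2 * c2)) + 1"
    using det'(1) unfolding e by (simp add: r s algebra_simps)
  ultimately show "\<exists>i j k l :: int. b' = 2 * sqrt 2 * of_int i \<and> b = 2 * sqrt 2 * of_int j \<and>
      Re a = 2 * sqrt 2 * of_int k \<and> Im a = 2 * of_int l + 1" by blast
qed

section \<open>From lattice vectors back to matrices\<close>

lemma Z_sqrt_m2_add: "x \<in> Z_sqrt_m2 \<Longrightarrow> y \<in> Z_sqrt_m2 \<Longrightarrow> x + y \<in> Z_sqrt_m2"
  unfolding Z_sqrt_m2_iff by (metis (no_types) of_int_add distrib_left plus_complex.sel)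

lemma Z_sqrt_m2_minus: "x \<in> Z_sqrt_m2 \<Longrightarrow> - x \<in> Z_sqrt_m2"
  unfolding Z_sqrt_m2_iff by (metis (no_types) of_int_minus mult_minus_right uminus_complex.sel)

lemma Z_sqrt_m2_mult: "x \<in> Z_sqrt_m2 \<Longrightarrow> y \<in> Z_sqrt_m2 \<Longrightarrow> x * y \<in> Z_sqrt_m2"
proof -
  assume "x \<in> Z_sqrt_m2" "y \<in> Z_sqrt_m2"
  then obtain a b c d :: int where e: "Re x = of_int a" "Im x = sqrt 2 * of_int b"
    "Re y = of_int c" "Im y = sqrt 2 * of_int d" unfolding Z_sqrt_m2_iff by blast
  show ?thesis unfolding Z_sqrt_m2_iff
    by (intro exI[of _ "a * c - 2 * (b * d)"] exI[of _ "a * d + b * c"])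
      (simp add: e algebra_simps)
qed

text \<open>Left multiplication of the matrix by the translation z + \<tau>, which moves the centre
  a / b to a / b + \<tau>.\<close>

lemma SL2_coords_translate:
  assumes "SL2_coords b' b a" "\<tau> \<in> Z_sqrt_m2"
  shows "SL2_coords (b' + 2 * Re (cnj a * \<tau>) + b * (cmod \<tau>)\<^sup>2) b (a + of_real b * \<tau>)"
proof -
  obtain \<alpha> \<beta> \<gamma> \<delta> where m: "\<alpha> \<in> Z_sqrt_m2" "\<beta> \<in> Z_sqrt_m2" "\<gamma> \<in> Z_sqrt_m2" "\<delta> \<in> Z_sqrt_m2"
    and det: "\<alpha> * \<delta> - \<beta> * \<gamma> = 1" and
    e: "b' = 2 * Im (\<beta> * cnj \<alpha>)" "b = 2 * Im (\<delta> * cnj \<gamma>)" "a = \<i> * (\<alpha> * cnj \<delta> - \<beta> * cnj \<gamma>)"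
    using assms(1) unfolding SL2_coords_def by blast
  show ?thesis unfolding SL2_coords_def
  proof (intro bexI conjI)
    show "(\<alpha> + \<tau> * \<gamma>) * \<delta> - (\<beta> + \<tau> * \<delta>) * \<gamma> = 1" using det by (simp add: algebra_simps)
    show "b' + 2 * Re (cnj a * \<tau>) + b * (cmod \<tau>)\<^sup>2 = 2 * Im ((\<beta> + \<tau> * \<delta>) * cnj (\<alpha> + \<tau> * \<gamma>))"
      unfolding e cmod_power2 by (simp add: power2_eq_square algebra_simps)
    show "a + of_real b * \<tau> = \<i> * ((\<alpha> + \<tau> * \<gamma>) * cnj \<delta> - (\<beta> + \<tau> * \<delta>) * cnj \<gamma>)"
      unfolding e by (rule complex_eqI) (simp_all add: algebra_simps)
  qed (use m e assms(2) in \<open>auto intro: Z_sqrt_m2_add Z_sqrt_m2_mult\<close>)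
qed

text \<open>Left multiplication by the matrix of -1/z: the rows are exchanged and one is
  negated.\<close>

lemma SL2_coords_invert:
  assumes "SL2_coords b' b a"
  shows "SL2_coords b b' (- cnj a)"
proof -
  obtain \<alpha> \<beta> \<gamma> \<delta> where m: "\<alpha> \<in> Z_sqrt_m2" "\<beta> \<in> Z_sqrt_m2" "\<gamma> \<in> Z_sqrt_m2" "\<delta> \<in> Z_sqrt_m2"
    and det: "\<alpha> * \<delta> - \<beta> * \<gamma> = 1" and
    e: "b' = 2 * Im (\<beta> * cnj \<alpha>)" "b = 2 * Im (\<delta> * cnj \<gamma>)" "a = \<i> * (\<alpha> * cnj \<delta> - \<beta> * cnj \<gamma>)"
    using assms(1) unfolding SL2_coords_def by blast
  show ?thesis unfolding SL2_coords_def
  proof (intro bexI conjI)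
    show "(- \<gamma>) * \<beta> - (- \<delta>) * \<alpha> = 1" using det by (simp add: algebra_simps)
    show "- cnj a = \<i> * ((- \<gamma>) * cnj \<beta> - (- \<delta>) * cnj \<alpha>)"
      unfolding e by (rule complex_eqI) (simp_all add: algebra_simps)
  qed (use m e in \<open>auto intro: Z_sqrt_m2_minus\<close>)
qed

lemma nearest_multiple:
  fixes x m :: int
  assumes "m \<noteq> 0"
  shows "\<exists>s. 2 * \<bar>x + m * s\<bar> \<le> \<bar>m\<bar>"
proof -
  define r where "r = x mod \<bar>m\<bar>"
  have r: "0 \<le> r" "r < \<bar>m\<bar>" using assms by (simp_all add: r_def)
  have x: "x = r + m * (sgn m * (x div \<bar>m\<bar>))"
    using mod_mult_div_eq[of x "\<bar>m\<bar>"] by (simp add: r_def abs_sgn mult.assoc)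
  show ?thesis
  proof (cases "2 * r \<le> \<bar>m\<bar>")
    case True
    then show ?thesis using r by (intro exI[of _ "- (sgn m * (x div \<bar>m\<bar>))"]) (subst x, simp)
  next
    case False
    have "x + m * (- (sgn m * (x div \<bar>m\<bar>)) - sgn m) = r - \<bar>m\<bar>"
      by (subst x) (simp add: algebra_simps abs_sgn)
    then show ?thesis using r False by (intro exI[of _ "- (sgn m * (x div \<bar>m\<bar>)) - sgn m"]) simp
  qed
qed

text \<open>Euclidean descent: translate the centre \<open>a / b\<close> of the circle into the fundamental
  domain of the lattice of integers, where the norm equation gives \<open>\<bar>b'\<bar> < \<bar>b\<bar>\<close>, and exchange
  \<open>b\<close> and \<open>b'\<close> by \<open>z \<mapsto> -1/z\<close>.\<close>

lemma lattice_SL2_coords: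
  fixes i j k l :: int
  assumes "8 * (i * j) = 8 * k\<^sup>2 + (2 * l + 1)\<^sup>2 - 1" "even l"
  shows "SL2_coords (2 * sqrt 2 * of_int i) (2 * sqrt 2 * of_int j)
    (Complex (2 * sqrt 2 * of_int k) (2 * of_int l + 1))"
  using assms
proof (induction "nat \<bar>j\<bar>" arbitrary: i j k l rule: less_induct)
  case less
  show ?case
  proof (cases "j = 0")
    case True
    have "8 * k\<^sup>2 + 4 * (l * (l + 1)) = 0"
      using less.prems(1) True by (simp add: power2_eq_square algebra_simps)
    moreover have "l * (l + 1) \<ge> 0" by (cases "l \<ge> 0") (auto simp: mult_nonpos_nonpos)
    ultimately have "k\<^sup>2 = 0" "l * (l + 1) = 0" by (smt (verit) zero_le_power2)+
    \<comment> \<open>Here \<open>l\<close> is 0 or -1, and evenness leaves 0: the circle is a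
      translate of the real line with \<open>a\<close> = i, and the matrix below is that
      translation.\<close>
    then have kl: "k = 0" "l = 0" using less.prems(2) by auto
    show ?thesis unfolding SL2_coords_def True kl
      by (intro bexI[of _ 1] bexI[of _ "Complex 0 (sqrt 2 * of_int i)"] bexI[of _ 0] conjI)
        (auto simp: Z_sqrt_m2_iff complex_eq_iff intro: exI[of _ 0] exI[of _ 1])
  next
    case False
    \<comment> \<open>The centre is k / j + i sqrt 2 (2 l + 1) / (4 j), so \<open>s\<close> and
      \<open>t\<close> round its two coordinates with respect to the basis 1, sqrt(-2).\<close>
    obtain s where s: "2 * \<bar>k + j * s\<bar> \<le> \<bar>j\<bar>" using nearest_multiple[OF False] by blast
    obtain t where t: "2 * \<bar>2 * l + 1 + 4 * j * t\<bar> \<le> \<bar>4 * j\<bar>"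
      using nearest_multiple[of "4 * j" "2 * l + 1"] False by auto
    define k1 where "k1 = k + j * s"
    \<comment> \<open>The shift of \<open>l\<close> is even, so the parity condition survives the
      translation.\<close>
    define l1 where "l1 = l + 2 * j * t"
    define i1 where "i1 = i + 2 * k * s + (2 * l + 1) * t + j * (s\<^sup>2 + 2 * t\<^sup>2)"
    have norm: "8 * (i1 * j) = 8 * k1\<^sup>2 + (2 * l1 + 1)\<^sup>2 - 1"
      using less.prems(1) unfolding i1_def k1_def l1_def by (simp add: power2_eq_square algebra_simps)
    \<comment> \<open>The bounds give 8 i1 j <= 2 j^2 + 4 j^2 - 1 < 8 j^2, while an odd square is at
      least 1, so \<open>i1 * j\<close> is not negative.\<close>
    have "(2 * k1)\<^sup>2 \<le> j\<^sup>2" unfolding abs_le_square_iff[symmetric] using s unfolding k1_def abs_mult by simp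
    moreover have "(2 * l1 + 1)\<^sup>2 \<le> (2 * j)\<^sup>2" unfolding abs_le_square_iff[symmetric]
      using t unfolding l1_def abs_mult by (simp add: algebra_simps)
    moreover have "(2 * l1 + 1)\<^sup>2 \<ge> 1"
    proof -
      have "2 * l1 + 1 \<noteq> 0" by presburger
      then have "(2 * l1 + 1)\<^sup>2 > 0" by simp
      then show ?thesis by linarith
    qed
    moreover have "(2 * k1)\<^sup>2 = 4 * k1\<^sup>2" "(2 * j)\<^sup>2 = 4 * j\<^sup>2" "j\<^sup>2 > 0" "k1\<^sup>2 \<ge> 0"
      using False by simp_all
    ultimately have "0 \<le> i1 * j" "i1 * j < j\<^sup>2"
      using norm by linarith+
    then have "\<bar>i1 * j\<bar> < \<bar>j * j\<bar>" by (simp add: power2_eq_square)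
    then have "\<bar>i1\<bar> * \<bar>j\<bar> < \<bar>j\<bar> * \<bar>j\<bar>" unfolding abs_mult .
    then have "\<bar>i1\<bar> < \<bar>j\<bar>" by (rule mult_right_less_imp_less) simp
    \<comment> \<open>Inversion replaces \<open>a\<close> by \<open>- cnj a\<close>: it negates
      \<open>k1\<close> and leaves \<open>l1\<close>, and with it the parity, unchanged.\<close>
    then have "SL2_coords (2 * sqrt 2 * of_int j) (2 * sqrt 2 * of_int i1)
        (Complex (2 * sqrt 2 * of_int (- k1)) (2 * of_int l1 + 1))"
      using norm less.prems(2) by (intro less.hyps) (simp_all add: l1_def mult.commute)
    from SL2_coords_invert[OF this]
    have 1: "SL2_coords (2 * sqrt 2 * of_int i1) (2 * sqrt 2 * of_int j)
        (Complex (2 * sqrt 2 * of_int k1) (2 * of_int l1 + 1))" (is "SL2_coords _ ?b ?a")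
      by (simp add: complex_eq_iff Complex_eq)
    let ?\<tau> = "Complex (- of_int s) (- sqrt 2 * of_int t)"
    have "?\<tau> \<in> Z_sqrt_m2" unfolding Z_sqrt_m2_iff
      by (intro exI[of _ "- s"] exI[of _ "- t"]) simp
    then have "SL2_coords (2 * sqrt 2 * of_int i1 + 2 * Re (cnj ?a * ?\<tau>) + ?b * (cmod ?\<tau>)\<^sup>2) ?b
        (?a + of_real ?b * ?\<tau>)"
      by (rule SL2_coords_translate[OF 1])
    moreover have "2 * sqrt 2 * of_int i1 + 2 * Re (cnj ?a * ?\<tau>) + ?b * (cmod ?\<tau>)\<^sup>2 = 2 * sqrt 2 * of_int i"
      unfolding cmod_power2 i1_def k1_def l1_def by (simp add: power2_eq_square algebra_simps)
    moreover have "?a + of_real ?b * ?\<tau> = Complex (2 * sqrt 2 * of_int k) (2 * of_int l + 1)"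
      unfolding k1_def l1_def by (rule complex_eqI) (simp_all add: algebra_simps)
    ultimately show ?thesis by simp
  qed
qed

text \<open>The last entry is any odd number: even \<open>l\<close> comes from matrices in SL2, odd
  \<open>l\<close> from the opposite orientation.\<close>

definition bianchi_vec :: "real^4 \<Rightarrow> bool" where
  "bianchi_vec v \<longleftrightarrow> pedoe v v = 1 \<and>
     (\<exists>i j k l :: int. v = vector [2 * sqrt 2 * of_int i, 2 * sqrt 2 * of_int j, 2 * sqrt 2 * of_int k, 2 * of_int l + 1])"

text \<open>Moves cubes and their sides into the lattice. Surjectivity is the arithmetic half,
  supplied by \<open>lattice_SL2_coords\<close>.\<close>

lemma circle_vec_bij: "bij_betw circle_vec {C. oriented_bianchi_circle C} {v. bianchi_vec v}"
proof (rule bij_betw_imageI)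
  show "inj_on circle_vec {C. oriented_bianchi_circle C}"
  proof (rule inj_onI)
    fix C D assume "C \<in> {C. oriented_bianchi_circle C}" "D \<in> {C. oriented_bianchi_circle C}"
      and eq: "circle_vec C = circle_vec D"
    then have C: "oriented_circle C" and D: "oriented_circle D" by (simp_all add: oriented_bianchi_circle_def)
    obtain b' b a where c: "circle_coords C b' b a" "circle_vec C = vector [b', b, Re a, Im a]"
      using oriented_circle_coords[OF C] .
    obtain e' e h where d: "circle_coords D e' e h" "circle_vec D = vector [e', e, Re h, Im h]"
      using oriented_circle_coords[OF D] .
    have "e' = b' \<and> e = b \<and> h = a"
      using eq unfolding c(2) d(2) by (simp add: vec_eq_iff forall_4 complex_eq_iff)
    then show "C = D" using circle_coords_inj[OF C c(1) D] d(1) by blast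
  qed
  show "circle_vec ` {C. oriented_bianchi_circle C} = {v. bianchi_vec v}"
  proof
    show "circle_vec ` {C. oriented_bianchi_circle C} \<subseteq> {v. bianchi_vec v}"
    proof clarify
      fix S T assume "oriented_bianchi_circle (S, T)"
      then have C: "oriented_circle (S, T)" "bianchi_circle S" by (simp_all add: oriented_bianchi_circle_def)
      obtain b' b a where c: "circle_coords (S, T) b' b a" "circle_vec (S, T) = vector [b', b, Re a, Im a]"
        using oriented_circle_coords[OF C(1)] .
      then have n: "b * b' = (cmod a)\<^sup>2 - 1" and S: "S = circle_points b' b a"
        by (simp_all add: circle_coords_def)
      obtain e' e h where e: "SL2_coords e' e h" "S = circle_points e' e h"
        using C(2) unfolding bianchi_circle_iff_coords by blast
      obtain i j k l :: int where l: "e' = 2 * sqrt 2 * of_int i" "e = 2 * sqrt 2 * of_int j"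
        "Re h = 2 * sqrt 2 * of_int k" "Im h = 2 * of_int l + 1"
        using SL2_coords_lattice(1)[OF e(1)] by blast
      from circle_points_eq[OF _ SL2_coords_lattice(2)[OF e(1)] n] S e(2)
      have "b' = e' \<and> b = e \<and> a = h \<or> b' = - e' \<and> b = - e \<and> a = - h" by simp
      then have "circle_vec (S, T) = vector [2 * sqrt 2 * of_int i, 2 * sqrt 2 * of_int j,
            2 * sqrt 2 * of_int k, 2 * of_int l + 1] \<or>
          circle_vec (S, T) = vector [2 * sqrt 2 * of_int (- i), 2 * sqrt 2 * of_int (- j),
            2 * sqrt 2 * of_int (- k), 2 * of_int (- l - 1) + 1]"
        unfolding c(2) by (elim disjE conjE) (simp_all add: l vec_eq_iff forall_4)
      moreover have "pedoe (circle_vec (S, T)) (circle_vec (S, T)) = 1"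
        unfolding c(2) pedoe_coords by (rule n)
      ultimately show "bianchi_vec (circle_vec (S, T))" unfolding bianchi_vec_def by blast
    qed
    show "{v. bianchi_vec v} \<subseteq> circle_vec ` {C. oriented_bianchi_circle C}"
    proof
      fix v assume "v \<in> {v. bianchi_vec v}"
      then obtain i j k l :: int where n: "pedoe v v = 1" and v: "v = vector [2 * sqrt 2 * of_int i,
          2 * sqrt 2 * of_int j, 2 * sqrt 2 * of_int k, 2 * of_int l + 1]"
        unfolding bianchi_vec_def by blast
      define b' where "b' = 2 * sqrt 2 * of_int i"
      define b where "b = 2 * sqrt 2 * of_int j"
      define a where "a = Complex (2 * sqrt 2 * of_int k) (2 * of_int l + 1)"
      have ve: "v = vector [b', b, Re a, Im a]" unfolding v b'_def b_def a_def by simp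
      have norm: "b * b' = (cmod a)\<^sup>2 - 1" using n unfolding ve pedoe_coords .
      then obtain C where C: "oriented_circle C" "circle_coords C b' b a"
        using circle_coords_exist by blast
      have "real_of_int (8 * (i * j)) = of_int (8 * k\<^sup>2 + (2 * l + 1)\<^sup>2 - 1)"
        using norm unfolding b'_def b_def a_def cmod_power2
        by (simp add: power_mult_distrib algebra_simps)
      then have int: "8 * (i * j) = 8 * k\<^sup>2 + (2 * l + 1)\<^sup>2 - 1" by (simp only: of_int_eq_iff)
      have "bianchi_circle (circle_points b' b a)"
      proof (cases "even l")
        case True
        show ?thesis unfolding bianchi_circle_iff_coords
          using lattice_SL2_coords[OF int True] b'_def b_def a_def by blast
      next
        case False
        \<comment> \<open>Reversing the orientation turns the odd \<open>l\<close> into the even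
          \<open>- l - 1\<close>.\<close>
        have "8 * (- i * - j) = 8 * (- k)\<^sup>2 + (2 * (- l - 1) + 1)\<^sup>2 - 1"
          using int by (simp add: power2_eq_square algebra_simps)
        moreover have "Complex (2 * sqrt 2 * of_int (- k)) (2 * of_int (- l - 1) + 1) = - a"
          by (simp add: a_def complex_eq_iff)
        ultimately have "SL2_coords (- b') (- b) (- a)"
          using lattice_SL2_coords[of "- i" "- j" "- k" "- l - 1"] False by (simp add: b'_def b_def)
        then show ?thesis unfolding bianchi_circle_iff_coords using circle_points_uminus by metis
      qed
      then have "oriented_bianchi_circle C"
        using C unfolding oriented_bianchi_circle_def circle_coords_def by simp
      moreover have "circle_vec C = v" using circle_vec_eq[OF C] ve by simp
      ultimately show "v \<in> circle_vec ` {C. oriented_bianchi_circle C}" by blast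
    qed
  qed
qed

text \<open>The coefficients 3, 3, -1, also the nontrivial column entries of
  \<open>cube_matrices\<close>, have odd sum 5, so the last entry stays odd.\<close>

lemma bianchi_vec_combination:
  assumes "bianchi_vec x" "bianchi_vec y" "bianchi_vec z"
    and n: "pedoe (3 *\<^sub>R (x + y) - z) (3 *\<^sub>R (x + y) - z) = 1"
  shows "bianchi_vec (3 *\<^sub>R (x + y) - z)"
proof -
  obtain i j k l i' j' k' l' i'' j'' k'' l'' :: int where
    x: "x = vector [2 * sqrt 2 * of_int i, 2 * sqrt 2 * of_int j, 2 * sqrt 2 * of_int k, 2 * of_int l + 1]" and
    y: "y = vector [2 * sqrt 2 * of_int i', 2 * sqrt 2 * of_int j', 2 * sqrt 2 * of_int k', 2 * of_int l' + 1]" and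
    z: "z = vector [2 * sqrt 2 * of_int i'', 2 * sqrt 2 * of_int j'', 2 * sqrt 2 * of_int k'', 2 * of_int l'' + 1]"
    using assms unfolding bianchi_vec_def by blast
  have "3 *\<^sub>R (x + y) - z = vector [2 * sqrt 2 * of_int (3 * (i + i') - i''),
      2 * sqrt 2 * of_int (3 * (j + j') - j''), 2 * sqrt 2 * of_int (3 * (k + k') - k''),
      2 * of_int (3 * (l + l') - l'' + 2) + 1]"
    unfolding x y z by (simp add: vec_eq_iff forall_4 algebra_simps)
  with n show ?thesis unfolding bianchi_vec_def by blast
qed

lemma bianchi_vec_neighbour:
  assumes P: "framed_cube P" "g \<in> directions P" and B: "\<And>v. v \<in> P \<Longrightarrow> bianchi_vec v"
    and x: "x \<in> neighbour P g"
  shows "bianchi_vec x"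
proof -
  obtain p q where f: "frame (center P) g p q" and Pe: "P = cube_points (center P) g p q"
    using framed_cube_cases[OF P] .
  define m where "m = center P"
  have F: "face P g = square (m + g) p q" unfolding m_def using face_cube_points[OF f] Pe by simp
  have n: "pedoe x x = 1" using framed_cube_norm[OF framed_cube_neighbour[OF P] x] .
  show ?thesis
  proof (cases "x \<in> face P g")
    case True
    then show ?thesis using B by (simp add: face_def)
  next
    case False
    then obtain y where "y \<in> square (m + g) p q" and xy: "x = y + 4 *\<^sub>R m + 6 *\<^sub>R g"
      using x unfolding neighbour_def F m_def by blast
    then obtain a b where ab: "a \<in> {1,-1::real}" "b \<in> {1,-1::real}"
      and y: "y = m + g + a *\<^sub>R p + b *\<^sub>R q" unfolding square_def by fastforce
    have mem: "m + c *\<^sub>R g + a' *\<^sub>R p + b' *\<^sub>R q \<in> P"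
      if "c \<in> {1,-1}" "a' \<in> {1,-1}" "b' \<in> {1,-1}" for a' b' c
      by (subst Pe) (use that in \<open>auto simp: mem_cube_points m_def\<close>)
    \<comment> \<open>\<open>?y'\<close> is opposite to \<open>y\<close> within the face,
      \<open>?z\<close> is the antipode of \<open>y\<close> in the cube; all three vertices belong
      to \<open>P\<close>.\<close>
    let ?y' = "m + 1 *\<^sub>R g + (- a) *\<^sub>R p + (- b) *\<^sub>R q"
      and ?z = "m + (- 1) *\<^sub>R g + (- a) *\<^sub>R p + (- b) *\<^sub>R q"
    have "m + 1 *\<^sub>R g + a *\<^sub>R p + b *\<^sub>R q \<in> P" by (rule mem) (use ab in auto)
    then have "y \<in> P" by (simp add: y)
    moreover have "?y' \<in> P" "?z \<in> P" by (rule mem; use ab in auto)+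
    moreover have xe: "x = 3 *\<^sub>R (y + ?y') - ?z" unfolding xy y by (simp add: vec_eq_iff)
    ultimately show ?thesis
      using bianchi_vec_combination[of y ?y' ?z] B n unfolding xe[symmetric] by blast
  qed
qed

section \<open>The cube graph\<close>

lemma framed_cube_circles:
  assumes "is_cube Cs"
  shows "framed_cube (circle_vec ` set Cs)"
    and "(`) circle_vec ` cube_sides Cs =
      face (circle_vec ` set Cs) ` directions (circle_vec ` set Cs)"
proof -
  define vs where "vs = map circle_vec Cs"
  have len: "length Cs = 8" using assms by (simp add: is_cube_def)
  have "length vs = 8" "\<forall>i<8. \<forall>j<8. pedoe (vs ! i) (vs ! j) = cube_gram ! i ! j"
    using assms by (auto simp: is_cube_def vs_def)
  then obtain m f p q where f: "frame m f p q" and vs: "vs = frame_list m f p q"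
    using gram_frame_list by blast
  have "circle_vec ` set Cs = set vs" by (simp add: vs_def)
  then have P: "circle_vec ` set Cs = cube_points m f p q" unfolding vs set_frame_list .
  then show "framed_cube (circle_vec ` set Cs)" unfolding framed_cube_def using f by blast
  have I: "i - 1 < 8" if "i \<in> I" "I \<in> side_indices" for i I using that by (auto simp: side_indices_def)
  have eq: "circle_vec (Cs ! (i - 1)) = vs ! (i - 1)" if "i \<in> I" "I \<in> side_indices" for i I
    using I[OF that] len by (simp add: vs_def)
  have "(`) circle_vec ` cube_sides Cs = {(\<lambda>i. vs ! (i - 1)) ` I | I. I \<in> side_indices}"
    unfolding cube_sides_def setcompr_eq_image image_image Collect_mem_eq by (intro image_cong) (simp_all only: eq)
  also have "\<dots> = face (circle_vec ` set Cs) ` directions (circle_vec ` set Cs)"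
    unfolding P vs by (rule sides_frame_list[OF f])
  finally show "(`) circle_vec ` cube_sides Cs =
      face (circle_vec ` set Cs) ` directions (circle_vec ` set Cs)" .
qed

lemma cube_bianchi: "is_cube Cs \<Longrightarrow> C \<in> set Cs \<Longrightarrow> oriented_bianchi_circle C"
  by (auto simp: is_cube_def in_set_conv_nth)

lemma framed_cube_is_cube:
  assumes "framed_cube V" "\<And>v. v \<in> V \<Longrightarrow> bianchi_vec v"
  obtains Cs where "is_cube Cs" "circle_vec ` set Cs = V"
proof -
  obtain m f p q where f: "frame m f p q" and V: "V = cube_points m f p q"
    using assms(1) unfolding framed_cube_def by blast
  let ?B = "{C. oriented_bianchi_circle C}"
  define Cs where "Cs = map (inv_into ?B circle_vec) (frame_list m f p q)"
  have im: "circle_vec ` ?B = {v. bianchi_vec v}" using circle_vec_bij by (rule bij_betw_imp_surj_on)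
  have b: "v \<in> circle_vec ` ?B" if "v \<in> set (frame_list m f p q)" for v
    using assms(2) that unfolding im V set_frame_list by blast
  have len: "length (frame_list m f p q) = 8" by (simp add: frame_list_def)
  have "map circle_vec Cs = map (\<lambda>v. v) (frame_list m f p q)"
    unfolding Cs_def map_map by (rule map_cong) (use b f_inv_into_f[of _ circle_vec ?B] in auto)
  then have vs: "map circle_vec Cs = frame_list m f p q" by simp
  have "\<forall>i<8. oriented_bianchi_circle (Cs ! i)"
    using b inv_into_into[of _ circle_vec ?B] len by (auto simp: Cs_def)
  moreover have "length Cs = 8" by (simp add: Cs_def len)
  moreover have "circle_vec (Cs ! i) = frame_list m f p q ! i" if "i < 8" for i
    using vs that \<open>length Cs = 8\<close> by (metis nth_map)
  ultimately have "is_cube Cs" unfolding is_cube_def using frame_list_gram[OF f] by simp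
  moreover have "circle_vec ` set Cs = V" unfolding V set_frame_list[symmetric] vs[symmetric] by simp
  ultimately show thesis by (rule that)
qed

lemma inj_on_image_bianchi: "inj_on ((`) circle_vec) {P. \<forall>C\<in>P. oriented_bianchi_circle C}"
proof (rule inj_onI)
  fix P Q assume "P \<in> {P. \<forall>C\<in>P. oriented_bianchi_circle C}" "Q \<in> {P. \<forall>C\<in>P. oriented_bianchi_circle C}"
    "circle_vec ` P = circle_vec ` Q"
  then show "P = Q" using inj_on_image_eq_iff[OF bij_betw_imp_inj_on[OF circle_vec_bij], of P Q] by blast
qed

lemma cube_verticesD:
  assumes "P \<in> cube_vertices"
  shows "framed_cube (circle_vec ` P)" "\<And>C. C \<in> P \<Longrightarrow> oriented_bianchi_circle C"
    "\<And>v. v \<in> circle_vec ` P \<Longrightarrow> bianchi_vec v"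
  using assms framed_cube_circles(1) cube_bianchi bij_betw_apply[OF circle_vec_bij]
  unfolding cube_vertices_def by auto

text \<open>The dictionary between the graph and reflections: a common side forces a reflection by
  \<open>common_face_neighbour\<close>, and a reflection keeps a side by
  \<open>face_neighbour\<close>. Injectivity on Bianchi circles carries equality of sides back from
  vectors.\<close>

lemma cube_edge_iff:
  assumes P: "P \<in> cube_vertices"
  shows "{P, Q} \<in> cube_edges \<longleftrightarrow>
    Q \<in> cube_vertices \<and> (\<exists>g\<in>directions (circle_vec ` P). circle_vec ` Q = neighbour (circle_vec ` P) g)"
proof
  assume "{P, Q} \<in> cube_edges"
  then obtain Cs Ds where "{P, Q} = {set Cs, set Ds}" and cubes: "is_cube Cs" "is_cube Ds"
    and neq: "set Cs \<noteq> set Ds" and "cube_sides Cs \<inter> cube_sides Ds \<noteq> {}"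
    unfolding cube_edges_def mem_Collect_eq by (elim exE conjE)
  then obtain F where F: "F \<in> cube_sides Cs" "F \<in> cube_sides Ds" by blast
  from \<open>{P, Q} = {set Cs, set Ds}\<close> have PQ': "P = set Cs \<and> Q = set Ds \<or> P = set Ds \<and> Q = set Cs"
    by (simp only: doubleton_eq_iff)
  have Q: "Q \<in> cube_vertices" unfolding cube_vertices_def using PQ' cubes by blast
  have PQ: "P \<noteq> Q" using PQ' neq by metis
  have "circle_vec ` F \<in> face (circle_vec ` set Es) ` directions (circle_vec ` set Es)"
    if "is_cube Es" "F \<in> cube_sides Es" for Es
    using framed_cube_circles(2)[OF that(1)] that(2) by blast
  from this[OF cubes(1) F(1)] this[OF cubes(2) F(2)]
  have "circle_vec ` F \<in> face (circle_vec ` P) ` directions (circle_vec ` P)"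
    and FQ: "circle_vec ` F \<in> face (circle_vec ` Q) ` directions (circle_vec ` Q)"
    using PQ' by metis+
  then obtain g where "circle_vec ` F = face (circle_vec ` P) g" "g \<in> directions (circle_vec ` P)"
    by (elim imageE)
  moreover from FQ obtain g' where "circle_vec ` F = face (circle_vec ` Q) g'" "g' \<in> directions (circle_vec ` Q)"
    by (elim imageE)
  ultimately have g: "g \<in> directions (circle_vec ` P)" "g' \<in> directions (circle_vec ` Q)"
    "face (circle_vec ` P) g = face (circle_vec ` Q) g'" by simp_all
  moreover have "circle_vec ` P \<noteq> circle_vec ` Q"
    using PQ inj_onD[OF inj_on_image_bianchi, of P Q] cube_verticesD(2) P Q by blast
  ultimately have "circle_vec ` Q = neighbour (circle_vec ` P) g"
    using common_face_neighbour cube_verticesD(1) P Q by metis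
  with g Q show "Q \<in> cube_vertices \<and>
      (\<exists>g\<in>directions (circle_vec ` P). circle_vec ` Q = neighbour (circle_vec ` P) g)" by blast
next
  assume "Q \<in> cube_vertices \<and>
    (\<exists>g\<in>directions (circle_vec ` P). circle_vec ` Q = neighbour (circle_vec ` P) g)"
  then obtain g where Q: "Q \<in> cube_vertices" and g: "g \<in> directions (circle_vec ` P)"
    and Qe: "circle_vec ` Q = neighbour (circle_vec ` P) g" by blast
  obtain Cs Ds where c: "is_cube Cs" "is_cube Ds" "P = set Cs" "Q = set Ds"
    using P Q unfolding cube_vertices_def by blast
  note n = cube_verticesD(1)[OF P] g
  have "P \<noteq> Q" using neighbour_neq[OF n] Qe by auto
  moreover have "face (circle_vec ` P) g \<in> (`) circle_vec ` cube_sides Cs"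
    unfolding framed_cube_circles(2)[OF c(1)] c(3)[symmetric] using g by (rule imageI)
  moreover have "face (circle_vec ` P) g \<in> (`) circle_vec ` cube_sides Ds"
    unfolding framed_cube_circles(2)[OF c(2)] c(4)[symmetric] Qe face_neighbour[OF n, symmetric]
    by (rule imageI) (rule back_direction_mem[OF n])
  ultimately have "\<exists>F\<in>cube_sides Cs. \<exists>F'\<in>cube_sides Ds. circle_vec ` F = circle_vec ` F'"
    by (elim imageE) (metis (no_types))
  then obtain F F' where F: "F \<in> cube_sides Cs" "F' \<in> cube_sides Ds"
    "circle_vec ` F = circle_vec ` F'" by blast
  have "\<forall>C\<in>F. oriented_bianchi_circle C" if "is_cube Es" "F \<in> cube_sides Es" for F Es
    using that by (auto simp: cube_sides_def side_indices_def is_cube_def)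
  then have "F = F'" using inj_onD[OF inj_on_image_bianchi F(3)] F c by blast
  with F have "cube_sides Cs \<inter> cube_sides Ds \<noteq> {}" by blast
  with c \<open>P \<noteq> Q\<close> show "{P, Q} \<in> cube_edges" unfolding cube_edges_def by blast
qed

lemma cube_edgesD:
  assumes "e \<in> cube_edges"
  shows "e \<subseteq> cube_vertices" "card e = 2"
proof -
  obtain Cs Ds where "e = {set Cs, set Ds}" "is_cube Cs" "is_cube Ds" "set Cs \<noteq> set Ds"
    using assms unfolding cube_edges_def mem_Collect_eq by (elim exE conjE)
  then show "e \<subseteq> cube_vertices" "card e = 2"
    by (auto simp only: cube_vertices_def insert_subset empty_subsetI mem_Collect_eq card_2_iff)
qed

text \<open>Each of the six directions gives a different reflected cube, and
  \<open>bianchi_vec_neighbour\<close> ensures that it consists of Bianchi circles.\<close>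

lemma valence_cube_graph:
  assumes P: "P \<in> cube_vertices"
  shows "valence cube_edges P = 6"
proof -
  let ?V = "circle_vec ` P"
  let ?N = "{Q. {P, Q} \<in> cube_edges}"
  have V: "framed_cube ?V" using cube_verticesD(1)[OF P] .
  have ne: "Q \<noteq> P" if "{P, Q} \<in> cube_edges" for Q
    using cube_edgesD(2)[OF that] by auto
  have "{e \<in> cube_edges. P \<in> e} = (\<lambda>Q. {P, Q}) ` ?N"
  proof
    show "{e \<in> cube_edges. P \<in> e} \<subseteq> (\<lambda>Q. {P, Q}) ` ?N"
    proof
      fix e assume e: "e \<in> {e \<in> cube_edges. P \<in> e}"
      then obtain x y where "e = {x, y}" using cube_edgesD(2)[of e] by (metis card_2_iff mem_Collect_eq)
      then obtain Q where "e = {P, Q}" using e by (metis (no_types, lifting) doubleton_eq_iff empty_iff insert_iff mem_Collect_eq)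
      with e show "e \<in> (\<lambda>Q. {P, Q}) ` ?N" by blast
    qed
  qed auto
  moreover have "inj_on (\<lambda>Q. {P, Q}) ?N" by (auto simp: inj_on_def doubleton_eq_iff)
  ultimately have "valence cube_edges P = card ?N" by (simp add: valence_def card_image)
  also have "\<dots> = card ((`) circle_vec ` ?N)"
  proof (rule card_image[symmetric], rule inj_on_subset[OF inj_on_image_bianchi])
    show "?N \<subseteq> {P. \<forall>C\<in>P. oriented_bianchi_circle C}"
      using cube_edge_iff[OF P] cube_verticesD(2) by blast
  qed
  also have "(`) circle_vec ` ?N = neighbour ?V ` directions ?V"
  proof
    show "(`) circle_vec ` ?N \<subseteq> neighbour ?V ` directions ?V" using cube_edge_iff[OF P] by blast
    show "neighbour ?V ` directions ?V \<subseteq> (`) circle_vec ` ?N"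
    proof clarify
      fix g assume g: "g \<in> directions ?V"
      obtain Cs where Cs: "is_cube Cs" "circle_vec ` set Cs = neighbour ?V g"
        using framed_cube_is_cube[OF framed_cube_neighbour[OF V g]]
          bianchi_vec_neighbour[OF V g cube_verticesD(3)[OF P]] by blast
      then have "{P, set Cs} \<in> cube_edges"
        using cube_edge_iff[OF P, of "set Cs"] g by (auto simp: cube_vertices_def)
      then show "neighbour ?V g \<in> (`) circle_vec ` ?N" using Cs(2) by blast
    qed
  qed
  also have "card \<dots> = card (directions ?V)" by (rule card_image[OF inj_on_neighbour[OF V]])
  also have "\<dots> = 6" using V card_directions unfolding framed_cube_def by auto
  finally show ?thesis .
qed

lemma no_cycle_cube_graph: "\<not> is_cycle cube_edges vs"
proof
  assume "is_cycle cube_edges vs"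
  then have n: "length vs \<ge> 3" and dist: "distinct vs"
    and edge: "\<And>i. i < length vs \<Longrightarrow> {vs ! i, vs ! (Suc i mod length vs)} \<in> cube_edges"
    unfolding is_cycle_def by auto
  let ?n = "length vs"
  \<comment> \<open>The cycle is traversed periodically as an infinite path; as its length is at
    least 3, hence no divisor of 2, the path never turns back, yet it returns after one
    round.\<close>
  define P where "P t = circle_vec ` (vs ! (t mod ?n))" for t
  have pos: "t mod ?n < ?n" for t using n by (intro mod_less_divisor) auto
  have e: "{vs ! (t mod ?n), vs ! (Suc t mod ?n)} \<in> cube_edges" for t
    using edge[OF pos[of t]] by (simp add: mod_Suc_eq)
  then have v: "vs ! (t mod ?n) \<in> cube_vertices" for t using cube_edgesD(1) by blast
  have inj: "s mod ?n = t mod ?n" if "P s = P t" for s t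
  proof -
    have "vs ! (s mod ?n) = vs ! (t mod ?n)"
      using that inj_onD[OF inj_on_image_bianchi] cube_verticesD(2)[OF v] unfolding P_def by blast
    then show ?thesis using nth_eq_iff_index_eq[OF dist pos pos] by blast
  qed
  obtain k where k: "?n = Suc k" using n by (cases ?n) auto
  have "P (Suc k) \<noteq> P 0"
  proof (rule path_no_return)
    show "framed_cube (P t)" for t unfolding P_def by (rule cube_verticesD(1)[OF v])
    show "\<exists>g\<in>directions (P t). P (Suc t) = neighbour (P t) g" for t
      using cube_edge_iff[OF v] e unfolding P_def by blast
    show "P (Suc (Suc t)) \<noteq> P t" for t
    proof
      assume "P (Suc (Suc t)) = P t"
      then have "Suc (Suc t) mod ?n = t mod ?n" by (rule inj)
      then have "?n dvd 2" using mod_eq_dvd_iff_nat[of t "Suc (Suc t)" ?n] by simp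
      then show False using n dvd_imp_le[of ?n 2] by simp
    qed
  qed
  moreover have "P (Suc k) = P 0" unfolding P_def k[symmetric] by simp
  ultimately show False by blast
qed

lemma forest_cube_graph: "forest cube_vertices cube_edges"
  unfolding forest_def using cube_edgesD no_cycle_cube_graph by blast

theorem theorem13p4:
  "forest cube_vertices cube_edges \<and>
   (\<forall>P\<in>cube_vertices. valence cube_edges P = 6) \<and>
   (\<forall>k<6. group.ord cube_group (cube_matrices ! k) = 2) \<and>
   (\<exists>\<phi> \<in> iso (free_product {..<6::nat} (\<lambda>_. integer_mod_group 2)) cube_group.
      \<forall>k<6. \<phi> (fp_incl {..<6} (\<lambda>_. integer_mod_group 2) k 1) = cube_matrices ! k)"
  using forest_cube_graph valence_cube_graph ord_cube_matrix cube_group_iso by auto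

end
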